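(* Let $n\ge 1$ and let $H:\mathbb{R}^n\times\mathbb{R}^n\to\mathbb{R}$ be a (possibly discontinuous) function satisfying: (i) $C:=\{(x,p)\in\mathbb{R}^n\times\mathbb{R}^n : H(x,p)\le 0\}$ is closed; (ii) for all $x\in\mathbb{R}^n$ the set $C_x:=\{p\in\mathbb{R}^n : H(x,p)\le 0\}$ is convex; (iii) $C_x=\overline{\{p\in\mathbb{R}^n : (x,p)\in C^\circ\}}$ for all $x\in\mathbb{R}^n$; (iv) there exist constants $0<\alpha_*\le\alpha^*$ such that $B_{1/\alpha^*}(0)\subset C_x\subset B_{1/\alpha_*}(0)$ for all $x\in\mathbb{R}^n$. Let $K\subset\mathbb{R}^n$ be nonempty, compact and connected, and let $u$ be the unique nonnegative viscosity solution of $$H(x,\nabla u)=0\ \text{ in }\mathbb{R}^n\setminus K,\qquad u=0\ \text{ on }K$$ (given by the representation formula recalled in the context). For $t>0$ set $U_t:=\{x\in\mathbb{R}^n : u(x)<t\}$. Then $$\alpha_*(t-r)\le\inf_{x\in\partial U_t}d(x,\partial U_r)\qquad\forall\,0<r\le t,$$ $$\sup_{x\in U_t}d(x,U_r)\le\alpha^*(t-r)\qquad\forall\,0<r\le t.$$ If, in addition, $K$ is a John domain with respect to a point $x_0\in K^\circ$ with John constant $\kappa_0\in(0,1]$, then for every $T>0$ one also has $$|U_t\setminus U_r|\le c\,(t-r)^\mu\qquad\forall\,0<r\le t\le T,$$ where $c>0$ and $\mu\in(0,1)$ depend only on $n$, $\alpha_*$, $\alpha^*$, $\kappa_0$, $d(x_0,\partial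 K)$, and $T$.
   Context: Notation: $B_r(y)=\{w\in\mathbb{R}^n : |w-y|<r\}$; $\overline{E}$ and $E^\circ$ denote closure and interior of a set $E$ (the interior $C^\circ$ is taken in $\mathbb{R}^n\times\mathbb{R}^n$); $d(x,E)=\inf_{y\in E}|x-y|$; $|E|$ is the $n$-dimensional Lebesgue measure of a set $E\subset\mathbb{R}^n$. John domain: a nonempty bounded set $U\subset\mathbb{R}^n$ is a John domain with respect to a fixed point $x_0\in U$ with John constant $\kappa\in(0,1]$ if for every $x\in U$ there is an arc-length parametrized curve $\rho:[0,L_\rho]\to U$ with $\rho(0)=x$, $\rho(L_\rho)=x_0$ and $d(\rho(s),\partial U)\ge\kappa s$ for all $s\in[0,L_\rho]$. The same definition (with curves taking values in $K$) is used for the compact set $K$. Viscosity solution: $u\in C(\mathbb{R}^n)$ is a viscosity solution of the problem if $u=0$ on $K$ and, for all $x\in\mathbb{R}^n\setminus K$ and all $\varphi\in C^1(\mathbb{R}^n)$: if $\varphi(x)-u(x)=\min(\varphi-u)$ then $H(x,\nabla\varphi(x))\le 0$; and if $\varphi(x)-u(x)=\max(\varphi-u)$ then $H(x,\nabla\varphi(x))\ge 0$. Standing fact (taken from the literature): under (i)–(iv) and for nonempty compact $K$, the unique nonnegative viscosity solution $u$ is characterized by $$u(x)=\min\Big\{\int_0^{L_\rho}\sigma(\rho(s),\dot\rho(s))\,ds : L_\rho\ge 0,\ \rho\in W^{1,\infty}(0,L_\rho;\mathbb{R}^n),\ |\dot\rho|=1\text{ a.e.},\ \rho(0)=x,\ \rho(L_\rho)\in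 K\Big\},$$ where $\sigma(x,v):=\sup\{-p\cdot v : p\in C_x\}$, and the minimum is attained. Throughout, "the unique nonnegative viscosity solution" means this function $u$. *)

theory Defs
  imports "HOL-Analysis.Analysis"
begin

definition sublevel_graph :: "('a::euclidean_space \<Rightarrow> 'a \<Rightarrow> real) \<Rightarrow> ('a \<times> 'a) set" where
  "sublevel_graph H = {(x, p). H x p \<le> 0}"

definition sublevel_fibre :: "('a::euclidean_space \<Rightarrow> 'a \<Rightarrow> real) \<Rightarrow> 'a \<Rightarrow> 'a set" where
  "sublevel_fibre H x = {p. H x p \<le> 0}"

definition admissible_hamiltonian ::
    "real \<Rightarrow> real \<Rightarrow> ('a::euclidean_space \<Rightarrow> 'a \<Rightarrow> real) \<Rightarrow> bool" where
  "admissible_hamiltonian a b H \<longleftrightarrow>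
     closed (sublevel_graph H) \<and>
     (\<forall>x. convex (sublevel_fibre H x)) \<and>
     (\<forall>x. sublevel_fibre H x = closure {p. (x, p) \<in> interior (sublevel_graph H)}) \<and>
     (\<forall>x. ball 0 (1 / b) \<subseteq> sublevel_fibre H x \<and> sublevel_fibre H x \<subseteq> ball 0 (1 / a))"

definition support_function :: "('a::euclidean_space \<Rightarrow> 'a \<Rightarrow> real) \<Rightarrow> 'a \<Rightarrow> 'a \<Rightarrow> real" where
  "support_function H x v = (SUP p \<in> sublevel_fibre H x. - (p \<bullet> v))"

text \<open>Curves in \<open>W\<^sup>1\<^sup>,\<^sup>\<infinity>(0, L)\<close> with unit speed a.e. The space \<open>W\<^sup>1\<^sup>,\<^sup>\<infinity>\<close> on a bounded interval is
  rendered by its continuous representatives, the Lipschitz functions on \<open>[0, L]\<close>, whose weak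
  derivative is the a.e. classical one. These are also exactly the curves parametrized by arc
  length. The case \<open>L = 0\<close> is a single point.\<close>

definition unit_speed_curve :: "real \<Rightarrow> (real \<Rightarrow> 'a::euclidean_space) \<Rightarrow> bool" where
  "unit_speed_curve L \<rho> \<longleftrightarrow>
     0 \<le> L \<and> (\<exists>M. M-lipschitz_on {0..L} \<rho>) \<and>
     (AE s in lebesgue. s \<in> {0<..<L} \<longrightarrow>
        \<rho> differentiable (at s) \<and> norm (vector_derivative \<rho> (at s)) = 1)"

definition curve_cost ::
    "('a::euclidean_space \<Rightarrow> 'a \<Rightarrow> real) \<Rightarrow> real \<Rightarrow> (real \<Rightarrow> 'a) \<Rightarrow> real" where
  "curve_cost H L \<rho> =
     (LINT s:{0..L}|lebesgue. support_function H (\<rho> s) (vector_derivative \<rho> (at s)))"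

text \<open>The nonnegative viscosity solution of \<open>H(x, \<nabla>u) = 0\<close> outside \<open>K\<close>, \<open>u = 0\<close> on \<open>K\<close>, identified
  with the function given by its representation formula. For admissible \<open>H\<close> and nonempty compact
  \<open>K\<close> the infimum is a minimum.\<close>

definition eikonal_solution ::
    "('a::euclidean_space \<Rightarrow> 'a \<Rightarrow> real) \<Rightarrow> 'a set \<Rightarrow> 'a \<Rightarrow> real" where
  "eikonal_solution H K x =
     Inf {curve_cost H L \<rho> |L \<rho>. unit_speed_curve L \<rho> \<and> \<rho> 0 = x \<and> \<rho> L \<in> K}"

definition reached_set ::
    "('a::euclidean_space \<Rightarrow> 'a \<Rightarrow> real) \<Rightarrow> 'a set \<Rightarrow> real \<Rightarrow> 'a set" where
  "reached_set H K t = {x. eikonal_solution H K x < t}"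

text \<open>Openness is deliberately not required: the notion is also applied to compact sets.\<close>

definition john_domain :: "'a::euclidean_space set \<Rightarrow> 'a \<Rightarrow> real \<Rightarrow> bool" where
  "john_domain U x0 \<kappa> \<longleftrightarrow>
     U \<noteq> {} \<and> bounded U \<and> x0 \<in> U \<and> 0 < \<kappa> \<and> \<kappa> \<le> 1 \<and>
     (\<forall>x\<in>U. \<exists>L \<rho>. unit_speed_curve L \<rho> \<and> \<rho> ` {0..L} \<subseteq> U \<and> \<rho> 0 = x \<and> \<rho> L = x0 \<and>
        (\<forall>s\<in>{0..L}. \<kappa> * s \<le> infdist (\<rho> s) (frontier U)))"

end

theory Submission
  imports Defs
begin

text \<open>
  Each \<open>C\<^sub>x\<close> lies between two balls about the origin, so moving at unit speed costs between \<open>1 / b\<close>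
  and \<open>1 / a\<close> per unit of length, where \<open>a\<close> and \<open>b\<close> stand for the constants \<open>\<alpha>1\<close> and \<open>\<alpha>2\<close>
  (\<open>partial_cost_bounds\<close>). The two distance estimates follow from these two rates alone.

  \<^item> Prefixing a straight segment to a curve shows that the solution \<open>u\<close> is \<open>1 / a\<close>-Lipschitz
    (\<open>solution_lipschitz\<close>). On the frontier of \<open>U\<^sub>t\<close> it takes the value \<open>t\<close>, so points of two such
    frontiers are at distance at least \<open>a (t - r)\<close>.
  \<^item> A curve from \<open>x\<close> to \<open>K\<close> of cost below \<open>t\<close> has spent at least \<open>t - r\<close> after length \<open>b (t - r)\<close>, so
    the rest costs less than \<open>r\<close>: by then the curve has entered \<open>U\<^sub>r\<close> (\<open>reached_set_near_earlier\<close>).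

  For the volume estimate, let \<open>E = U\<^sub>t - U\<^sub>r\<close> and \<open>\<epsilon> = b (t - r)\<close>. From a point of \<open>U\<^sub>r\<close> one can walk
  to the John centre \<open>x0\<close>, first along a nearly optimal curve to \<open>K\<close> and then along a John curve in
  \<open>K\<close>. After length \<open>s\<close> the walk is at the centre of a ball inside \<open>U\<^sub>r\<close> of radius comparable to \<open>s\<close>:
  on the first part because \<open>u\<close> has dropped by \<open>s / b\<close> below \<open>r\<close> and is Lipschitz, on the second part
  by the John condition (\<open>reached_set_corkscrew\<close>). As \<open>E\<close> lies outside \<open>U\<^sub>r\<close> but within \<open>\<epsilon>\<close> of it, \<open>E\<close>
  is porous at all scales from \<open>4 \<epsilon>\<close> up to \<open>d(x0, \<partial>K)\<close> (\<open>porous_reached_annulus\<close>).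

  Porosity makes the volume of neighbourhoods of \<open>E\<close> decay geometrically. Near each point of the
  \<open>\<rho>\<close>-neighbourhood \<open>E\<^sub>\<rho>\<close> there is a ball of radius \<open>\<rho>\<close> that lies in the larger neighbourhood \<open>E\<^sub>M\<^sub>\<rho>\<close>
  but misses \<open>E\<^sub>\<rho>\<close>. Counting pairs of nearby points with Tonelli's theorem gives
  \<open>|E\<^sub>\<rho>| \<le> M\<^sup>n |E\<^sub>M\<^sub>\<rho> - E\<^sub>\<rho>|\<close> (\<open>emeasure_le_of_nearby_balls\<close>), hence \<open>|E\<^sub>\<rho>| \<le> q |E\<^sub>M\<^sub>\<rho>|\<close> with \<open>q < 1\<close>
  depending only on \<open>n\<close> and the porosity constant. Iterating this over geometrically growing \<open>\<rho>\<close>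
  yields a bound \<open>c \<epsilon> powr \<mu>\<close> with \<open>M powr \<mu> * q = 1\<close> (\<open>porous_volume_bound\<close>).
\<close>

section \<open>Unit-speed curves\<close>

lemma lipschitz_clamp:
  fixes f :: "real \<Rightarrow> 'a::metric_space"
  assumes "M-lipschitz_on {a..b} f" "a \<le> b"
  shows "M-lipschitz_on UNIV (\<lambda>s. f (max a (min b s)))"
proof (rule lipschitz_onI)
  fix x y :: real
  have "dist (f (max a (min b x))) (f (max a (min b y)))
      \<le> M * dist (max a (min b x)) (max a (min b y))"
    using assms by (intro lipschitz_onD[OF assms(1)]) auto
  also have "\<dots> \<le> M * dist x y"
    by (intro mult_left_mono lipschitz_on_nonneg[OF assms(1)]) (auto simp: dist_real_def)
  finally show "dist (f (max a (min b x))) (f (max a (min b y))) \<le> M * dist x y" .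
qed (rule lipschitz_on_nonneg[OF assms(1)])


text \<open>
  The boundary terms left over when a difference quotient of step \<open>1 / (n + 1)\<close> is integrated.
\<close>

lemma tendsto_average_lipschitz:
  fixes F :: "real \<Rightarrow> 'a::euclidean_space"
  assumes lip: "M-lipschitz_on UNIV F"
  shows "(\<lambda>n. real (Suc n) *\<^sub>R integral {c..c + 1 / real (Suc n)} F) \<longlonglongrightarrow> F c"
proof -
  have cont: "continuous_on S F" for S
    using lipschitz_on_continuous_on[OF lip] continuous_on_subset by blast
  have M: "0 \<le> M" by (rule lipschitz_on_nonneg[OF lip])
  have bound: "norm (real (Suc n) *\<^sub>R integral {c..c + 1 / real (Suc n)} F - F c)
      \<le> M * (1 / real (Suc n))" for n
  proof -
    define h where "h = 1 / real (Suc n)"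
    have h: "0 < h" "real (Suc n) = 1 / h" by (auto simp: h_def)
    have "norm (integral {c..c+h} (\<lambda>x. F x - F c)) \<le> (M * h) * (c + h - c)"
    proof (rule integral_bound)
      fix t assume t: "t \<in> {c..c+h}"
      have "norm (F t - F c) \<le> M * dist t c"
        using lipschitz_onD[OF lip, of t c] by (simp add: dist_norm)
      also have "\<dots> \<le> M * h"
        using t M by (intro mult_left_mono) (auto simp: dist_real_def)
      finally show "norm (F t - F c) \<le> M * h" .
    qed (use h in \<open>auto intro!: continuous_intros cont\<close>)
    moreover have "integral {c..c+h} (\<lambda>x. F x - F c) = integral {c..c+h} F - h *\<^sub>R F c"
      using h by (subst integral_diff) (auto intro!: integrable_continuous_interval cont)
    moreover have "(1 / h) *\<^sub>R integral {c..c+h} F - F c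
        = (1 / h) *\<^sub>R (integral {c..c+h} F - h *\<^sub>R F c)"
      using h by (simp add: scaleR_diff_right)
    ultimately have "norm ((1 / h) *\<^sub>R integral {c..c+h} F - F c) \<le> (M * h * h) / h"
      using h divide_right_mono[of "norm (integral {c..c+h} F - h *\<^sub>R F c)" "M * h * h" h] by simp
    then show ?thesis
      using h unfolding h_def[symmetric] h(2) by simp
  qed
  have "(\<lambda>n. M * (1 / real (Suc n))) \<longlonglongrightarrow> M * 0"
    by (intro tendsto_mult tendsto_const LIMSEQ_Suc[OF lim_1_over_n])
  then have "(\<lambda>n. real (Suc n) *\<^sub>R integral {c..c + 1 / real (Suc n)} F - F c) \<longlonglongrightarrow> 0"
    by (intro Lim_null_comparison[OF always_eventually[OF allI[OF bound]]]) simp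
  then show ?thesis by (simp only: LIM_zero_iff)
qed

text \<open>
  An equivalence, so that \<open>vector_derivative\<close>, which is a choice of derivative, transforms in the
  same way at points of non-differentiability.
\<close>

lemma has_vector_derivative_shift_iff:
  "((\<lambda>s. f (c + s)) has_vector_derivative D) (at s) \<longleftrightarrow>
     (f has_vector_derivative D) (at (c + s))"
  by (simp add: has_vector_derivative_def has_derivative_at add.assoc)

lemma vector_derivative_shift:
  "vector_derivative (\<lambda>s. f (c + s)) (at s) = vector_derivative f (at (c + s))"
  by (simp add: vector_derivative_def has_vector_derivative_shift_iff)

lemma has_vector_derivative_quotient_tendsto:
  assumes "(f has_vector_derivative D) (at s)"
  shows "((\<lambda>h. inverse h *\<^sub>R (f (s + h) - f s)) \<longlongrightarrow> D) (at 0)"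
proof (rule LIM_zero_cancel, rule tendsto_norm_zero_cancel)
  have "((\<lambda>h. norm (f (s + h) - f s - h *\<^sub>R D) / norm h) \<longlongrightarrow> 0) (at 0)"
    using assms by (simp add: has_vector_derivative_def has_derivative_at)
  moreover have "\<forall>\<^sub>F h in at 0. norm (f (s + h) - f s - h *\<^sub>R D) / norm h
      = norm (inverse h *\<^sub>R (f (s + h) - f s) - D)"
  proof -
    have "norm (f (s + h) - f s - h *\<^sub>R D) / norm h
        = norm (inverse h *\<^sub>R (f (s + h) - f s) - D)" if "h \<noteq> 0" for h
    proof -
      have "inverse h *\<^sub>R (f (s + h) - f s) - D = inverse h *\<^sub>R (f (s + h) - f s - h *\<^sub>R D)"
        using that by (simp add: scaleR_diff_right)
      then show ?thesis
        by (simp add: divide_inverse mult.commute)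
    qed
    then show ?thesis by (simp add: eventually_at_filter)
  qed
  ultimately show "((\<lambda>h. norm (inverse h *\<^sub>R (f (s + h) - f s) - D)) \<longlongrightarrow> 0) (at 0)"
    by (rule Lim_transform_eventually)
qed

text \<open>
  The fundamental theorem of calculus for Lipschitz curves. The difference quotients are bounded by
  the Lipschitz constant and converge almost everywhere to the derivative, so the derivative is
  measurable and dominated convergence applies. The integral of a quotient is a difference of averages
  of \<open>f\<close> to the right of \<open>b\<close> and of \<open>a\<close>.
\<close>

lemma lipschitz_derivative_integral:
  fixes f :: "real \<Rightarrow> 'a::euclidean_space"
  assumes lip: "M-lipschitz_on {a..b} f" and ab: "a \<le> b"
    and diff: "AE s in lebesgue. s \<in> {a<..<b} \<longrightarrow> f differentiable (at s)"
  shows "(\<lambda>s. indicator {a<..<b} s *\<^sub>R vector_derivative f (at s)) \<in> borel_measurable lebesgue"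
      (is "?D \<in> _")
    and "(LINT s|lebesgue. indicator {a<..<b} s *\<^sub>R vector_derivative f (at s)) = f b - f a"
proof -
  \<comment> \<open>Extended by constants, so that the quotients near \<open>b\<close> make sense.\<close>
  define F where "F = (\<lambda>s. f (max a (min b s)))"
  have lipF: "M-lipschitz_on UNIV F"
    unfolding F_def by (rule lipschitz_clamp[OF lip ab])
  have M: "0 \<le> M" by (rule lipschitz_on_nonneg[OF lip])
  have contF: "continuous_on S F" for S
    using lipschitz_on_continuous_on[OF lipF] continuous_on_subset by blast
  have [measurable]: "F \<in> borel_measurable borel"
    by (intro borel_measurable_continuous_onI contF)
  define q where
    "q n s = indicator {a<..<b} s *\<^sub>R (real (Suc n) *\<^sub>R (F (s + 1 / real (Suc n)) - F s))" for n s
  have q_borel: "q n \<in> borel_measurable borel" for n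
    unfolding q_def by measurable
  have q_meas: "q n \<in> borel_measurable lebesgue" for n
    using q_borel[of n] by (simp add: measurable_completion)
  have q_lim: "AE s in lebesgue. (\<lambda>n. q n s) \<longlonglongrightarrow> ?D s"
    using diff
  proof eventually_elim
    case (elim s)
    show ?case
    proof (cases "s \<in> {a<..<b}")
      case True
      then have "(f has_vector_derivative vector_derivative f (at s)) (at s)"
        using elim vector_derivative_works by blast
      moreover have "eventually (\<lambda>x. x \<in> {a<..<b}) (nhds s)"
        using True by (intro eventually_nhds_in_open) auto
      then have "eventually (\<lambda>x. f x = F x) (nhds s)"
        by eventually_elim (auto simp: F_def)
      ultimately have "(F has_vector_derivative vector_derivative f (at s)) (at s)"
        using has_vector_derivative_cong_ev[where f = f and g = F and S = UNIV and x = s]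
          eventually_nhds_x_imp_x[of "\<lambda>x. f x = F x" s] by simp
      then have "((\<lambda>h. inverse h *\<^sub>R (F (s + h) - F s)) \<longlongrightarrow> vector_derivative f (at s)) (at 0)"
        by (rule has_vector_derivative_quotient_tendsto)
      moreover have "filterlim (\<lambda>n. 1 / real (Suc n)) (at 0) sequentially"
        using LIMSEQ_Suc[OF lim_1_over_n] by (auto simp: filterlim_at)
      ultimately have "(\<lambda>n. inverse (1 / real (Suc n)) *\<^sub>R (F (s + 1 / real (Suc n)) - F s))
          \<longlonglongrightarrow> vector_derivative f (at s)"
        by (rule filterlim_compose)
      then show ?thesis using True by (simp add: q_def del: of_nat_Suc)
    qed (simp add: q_def)
  qed
  have q_bound: "norm (q n s) \<le> M * indicator {a..b} s" for n s
  proof (cases "s \<in> {a<..<b}")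
    case True
    have "norm (F (s + 1 / real (Suc n)) - F s) \<le> M * (1 / real (Suc n))"
      using lipschitz_onD[OF lipF, of "s + 1 / real (Suc n)" s] by (simp add: dist_norm)
    then have "real (Suc n) * norm (F (s + 1 / real (Suc n)) - F s) \<le> M"
      by (simp add: field_simps del: of_nat_Suc)
    then show ?thesis using True by (simp add: q_def)
  qed (use M in \<open>auto simp: q_def indicator_def\<close>)
  show D_meas: "?D \<in> borel_measurable lebesgue"
  proof (rule borel_measurable_AE)
    show "(\<lambda>s. lim (\<lambda>n. q n s)) \<in> borel_measurable lebesgue"
      by (intro borel_measurable_lim_metric q_meas)
    show "AE s in lebesgue. lim (\<lambda>n. q n s) = ?D s"
      using q_lim by eventually_elim (rule limI)
  qed
  have "(\<lambda>n. LINT s|lebesgue. q n s) \<longlonglongrightarrow> (LINT s|lebesgue. ?D s)"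
  proof (rule integral_dominated_convergence[where w = "\<lambda>s. M * indicator {a..b} s"])
    show "integrable lebesgue (\<lambda>s. M * indicator {a..b} s :: real)"
      using ab by (intro integrable_mult_right integrable_real_indicator) simp_all
  qed (use D_meas q_meas q_lim q_bound in auto)
  moreover have "(\<lambda>n. LINT s|lebesgue. q n s) \<longlonglongrightarrow> f b - f a"
  proof -
    have "(LINT s|lebesgue. q n s) =
        real (Suc n) *\<^sub>R integral {b..b + 1 / real (Suc n)} F
        - real (Suc n) *\<^sub>R integral {a..a + 1 / real (Suc n)} F" for n
    proof -
      define h where "h = 1 / real (Suc n)"
      have h: "0 < h" by (simp add: h_def)
      define Q where "Q s = real (Suc n) *\<^sub>R (F (s + h) - F s)" for s
      have contQ: "continuous_on S Q" for S
        unfolding Q_def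
        by (intro continuous_intros continuous_on_compose2[OF contF[of UNIV]] contF) auto
      have "(LINT s|lebesgue. q n s) = (LINT s:{a..b}|lebesgue. Q s)"
        unfolding set_lebesgue_integral_def
        by (rule integral_discrete_difference[of "{a, b}"])
           (auto simp: q_def Q_def h_def indicator_def)
      also have "\<dots> = integral {a..b} Q"
        by (intro set_lebesgue_integral_eq_integral absolutely_integrable_continuous_real contQ)
      also have "\<dots> = real (Suc n) *\<^sub>R (integral {a..b} (\<lambda>s. F (s + h)) - integral {a..b} F)"
        unfolding Q_def
        by (subst integral_cmul, subst integral_diff)
           (auto intro!: integrable_continuous_interval contF continuous_intros
              continuous_on_compose2[OF contF[of UNIV]])
      also have "integral {a..b} (\<lambda>s. F (s + h)) = integral {a+h..b+h} F"
        using integral_shift_real_ivl[of "a + h" h "b + h" F] by simp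
      also have "integral {a+h..b+h} F - integral {a..b} F
          = integral {b..b+h} F - integral {a..a+h} F"
      proof -
        have *: "F integrable_on {a..b+h}"
          by (intro integrable_continuous_interval contF)
        have "integral {a..b} F + integral {b..b+h} F = integral {a..a+h} F + integral {a+h..b+h} F"
          using Henstock_Kurzweil_Integration.integral_combine[OF _ _ *, of b]
            Henstock_Kurzweil_Integration.integral_combine[OF _ _ *, of "a+h"] h ab by simp
        then show ?thesis by (simp add: algebra_simps)
      qed
      finally show ?thesis by (simp add: scaleR_diff_right h_def)
    qed
    moreover have "F b = f b" "F a = f a" using ab by (auto simp: F_def)
    ultimately show ?thesis
      using tendsto_diff[OF tendsto_average_lipschitz[OF lipF, of b]
          tendsto_average_lipschitz[OF lipF, of a]] by simp
  qed
  ultimately show "(LINT s|lebesgue. ?D s) = f b - f a"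
    by (rule LIMSEQ_unique)
qed

text \<open>
  A unit-speed curve comes with some Lipschitz constant; integrating its derivative improves that
  constant to \<open>1\<close>, so arc length bounds distance.
\<close>

lemma unit_speed_1_lipschitz:
  assumes "unit_speed_curve L \<rho>" "0 \<le> s" "s \<le> t" "t \<le> L"
  shows "dist (\<rho> s) (\<rho> t) \<le> t - s"
proof -
  obtain M where lip: "M-lipschitz_on {0..L} \<rho>"
    and ae: "AE r in lebesgue. r \<in> {0<..<L} \<longrightarrow>
        \<rho> differentiable (at r) \<and> norm (vector_derivative \<rho> (at r)) = 1"
    using assms by (auto simp: unit_speed_curve_def)
  let ?D = "\<lambda>r. indicator {s<..<t} r *\<^sub>R vector_derivative \<rho> (at r)"
  have lip': "M-lipschitz_on {s..t} \<rho>"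
    by (rule lipschitz_on_subset[OF lip]) (use assms in auto)
  have ae': "AE r in lebesgue. r \<in> {s<..<t} \<longrightarrow> \<rho> differentiable (at r)"
    using ae by eventually_elim (use assms in auto)
  note D = lipschitz_derivative_integral[OF lip' \<open>s \<le> t\<close> ae']
  have bd: "AE r in lebesgue. norm (?D r) \<le> indicator {s<..<t} r"
    using ae by eventually_elim (use assms in \<open>auto simp: indicator_def\<close>)
  have I: "integrable lebesgue (indicator {s<..<t} :: real \<Rightarrow> real)"
    using \<open>s \<le> t\<close> by (intro integrable_real_indicator) simp_all
  have ID: "integrable lebesgue ?D"
    by (rule Bochner_Integration.integrable_bound[OF I D(1)])
       (use bd in \<open>auto elim: eventually_mono\<close>)
  have "dist (\<rho> s) (\<rho> t) = norm (LINT r|lebesgue. ?D r)"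
    using D(2) by (simp add: dist_norm norm_minus_commute)
  also have "\<dots> \<le> (LINT r|lebesgue. norm (?D r))"
    by (rule integral_norm_bound)
  also have "\<dots> \<le> (LINT r|lebesgue. indicator {s<..<t} r)"
    by (rule integral_mono_AE[OF integrable_norm[OF ID] I bd])
  also have "\<dots> = t - s"
    using assms by simp
  finally show ?thesis .
qed

lemma AE_lebesgue_neq: "AE s in lebesgue. s \<noteq> (c::real)"
  by (rule AE_I'[of "{c}"]) (simp_all add: negligible_iff_null_sets[symmetric])

lemma unit_speed_curveD:
  assumes "unit_speed_curve L \<rho>"
  shows "0 \<le> L" "\<exists>M. M-lipschitz_on {0..L} \<rho>"
    and "AE s in lebesgue. s \<in> {0<..<L} \<longrightarrow> \<rho> differentiable (at s)"
    and "AE s in lebesgue. s \<in> {0<..<L} \<longrightarrow> norm (vector_derivative \<rho> (at s)) = 1"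
proof -
  have *: "AE s in lebesgue. s \<in> {0<..<L} \<longrightarrow>
        \<rho> differentiable (at s) \<and> norm (vector_derivative \<rho> (at s)) = 1"
    using assms by (simp add: unit_speed_curve_def)
  from * show "AE s in lebesgue. s \<in> {0<..<L} \<longrightarrow> \<rho> differentiable (at s)"
    by eventually_elim simp
  from * show "AE s in lebesgue. s \<in> {0<..<L} \<longrightarrow> norm (vector_derivative \<rho> (at s)) = 1"
    by eventually_elim simp
qed (use assms in \<open>auto simp: unit_speed_curve_def\<close>)

lemma AE_lebesgue_shift:
  assumes "AE s in lebesgue. P (s::real)"
  shows "AE s in lebesgue. P (c + s)"
proof -
  obtain N where N: "negligible N" "{s. \<not> P s} \<subseteq> N"
    using assms by (auto simp: eventually_ae_filter negligible_iff_null_sets)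
  have "negligible ((+) (- c) ` N)"
    by (rule negligible_translation[OF N(1)])
  moreover have "{s. \<not> P (c + s)} \<subseteq> (+) (- c) ` N"
  proof
    fix s assume "s \<in> {s. \<not> P (c + s)}"
    then have "c + s \<in> N" using N(2) by auto
    then show "s \<in> (+) (- c) ` N" by (intro image_eqI[of _ _ "c + s"]) auto
  qed
  ultimately show ?thesis
    by (auto simp: eventually_ae_filter negligible_iff_null_sets)
qed

lemma unit_speed_curve_shift:
  assumes \<rho>: "unit_speed_curve L \<rho>" and c: "0 \<le> c" "c \<le> L"
  shows "unit_speed_curve (L - c) (\<lambda>s. \<rho> (c + s))"
proof -
  obtain M where lip: "M-lipschitz_on {0..L} \<rho>"
    and ae: "AE r in lebesgue. r \<in> {0<..<L} \<longrightarrow>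
        \<rho> differentiable (at r) \<and> norm (vector_derivative \<rho> (at r)) = 1"
    using \<rho> by (auto simp: unit_speed_curve_def)
  have "M-lipschitz_on {0..L - c} (\<lambda>s. \<rho> (c + s))"
  proof (rule lipschitz_onI)
    fix x y assume "x \<in> {0..L - c}" "y \<in> {0..L - c}"
    then show "dist (\<rho> (c + x)) (\<rho> (c + y)) \<le> M * dist x y"
      using lipschitz_onD[OF lip, of "c + x" "c + y"] c by (auto simp: dist_real_def)
  qed (rule lipschitz_on_nonneg[OF lip])
  moreover have "AE r in lebesgue. r \<in> {0<..<L - c} \<longrightarrow> (\<lambda>s. \<rho> (c + s)) differentiable (at r) \<and>
      norm (vector_derivative (\<lambda>s. \<rho> (c + s)) (at r)) = 1"
    using AE_lebesgue_shift[OF ae, of c]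
  proof eventually_elim
    case (elim r)
    show ?case
    proof
      assume "r \<in> {0<..<L - c}"
      with elim c have d: "\<rho> differentiable (at (c + r))"
        and n: "norm (vector_derivative \<rho> (at (c + r))) = 1" by auto
      from d have "(\<rho> has_vector_derivative vector_derivative \<rho> (at (c + r))) (at (c + r))"
        by (simp add: vector_derivative_works)
      then have "(\<lambda>s. \<rho> (c + s)) differentiable (at r)"
        unfolding has_vector_derivative_shift_iff[symmetric] by (rule differentiableI_vector)
      with n show "(\<lambda>s. \<rho> (c + s)) differentiable (at r) \<and>
          norm (vector_derivative (\<lambda>s. \<rho> (c + s)) (at r)) = 1"
        by (simp add: vector_derivative_shift)
    qed
  qed
  ultimately show ?thesis using c by (auto simp: unit_speed_curve_def)
qed

text \<open>
  The cost of a tail of \<open>\<rho>\<close>, reparametrized to start at time \<open>0\<close>.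
\<close>

lemma curve_cost_shift:
  "curve_cost H (L - c) (\<lambda>s. \<rho> (c + s)) =
     (LINT s:{c..L}|lebesgue. support_function H (\<rho> s) (vector_derivative \<rho> (at s)))"
proof -
  have "(LINT s:{c..L}|lebesgue. support_function H (\<rho> s) (vector_derivative \<rho> (at s))) =
    (LINT s|lebesgue. indicator {c..L} (c + s) *\<^sub>R
        support_function H (\<rho> (c + s)) (vector_derivative \<rho> (at (c + s))))"
    unfolding set_lebesgue_integral_def
    by (subst lebesgue_integral_real_affine[of 1 _ c]) auto
  also have "\<dots> = curve_cost H (L - c) (\<lambda>s. \<rho> (c + s))"
    unfolding curve_cost_def set_lebesgue_integral_def vector_derivative_shift
    by (intro Bochner_Integration.integral_cong) (auto simp: indicator_def)
  finally show ?thesis by simp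
qed

text \<open>
  A curve need not be differentiable at the ends of a piece, and its derivative there is an arbitrary
  value; the cost does not see it.
\<close>

lemma set_integral_cong_interior:
  fixes f g :: "real \<Rightarrow> 'b::{banach, second_countable_topology}"
  assumes "\<And>s. a < s \<Longrightarrow> s < b \<Longrightarrow> f s = g s"
  shows "(LINT s:{a..b}|lebesgue. f s) = (LINT s:{a..b}|lebesgue. g s)"
  unfolding set_lebesgue_integral_def
  by (rule integral_discrete_difference[of "{a, b}"]) (use assms in \<open>auto simp: indicator_def\<close>)

definition join_curves :: "real \<Rightarrow> (real \<Rightarrow> 'a) \<Rightarrow> (real \<Rightarrow> 'a) \<Rightarrow> real \<Rightarrow> 'a" where
  "join_curves L \<sigma> \<rho> s = (if s \<le> L then \<sigma> s else \<rho> (s - L))"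

lemma has_vector_derivative_join_left:
  assumes "s < L"
  shows "(join_curves L \<sigma> \<rho> has_vector_derivative D) (at s) \<longleftrightarrow> (\<sigma> has_vector_derivative D) (at s)"
proof -
  have "eventually (\<lambda>r. r \<in> {..<L}) (nhds s)"
    using assms by (intro eventually_nhds_in_open) auto
  then have "\<forall>\<^sub>F r in nhds s. r \<in> UNIV \<longrightarrow> join_curves L \<sigma> \<rho> r = \<sigma> r"
    by eventually_elim (simp add: join_curves_def)
  then show ?thesis
    by (rule has_vector_derivative_cong_ev) (use assms in \<open>simp add: join_curves_def\<close>)
qed

lemma has_vector_derivative_join_right:
  assumes "L < s"
  shows "(join_curves L \<sigma> \<rho> has_vector_derivative D) (at s) \<longleftrightarrow>
    (\<rho> has_vector_derivative D) (at (s - L))"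
proof -
  have "eventually (\<lambda>r. r \<in> {L<..}) (nhds s)"
    using assms by (intro eventually_nhds_in_open) auto
  then have "\<forall>\<^sub>F r in nhds s. r \<in> UNIV \<longrightarrow> join_curves L \<sigma> \<rho> r = \<rho> (- L + r)"
    by eventually_elim (simp add: join_curves_def)
  then have "(join_curves L \<sigma> \<rho> has_vector_derivative D) (at s) \<longleftrightarrow>
      ((\<lambda>r. \<rho> (- L + r)) has_vector_derivative D) (at s)"
    by (rule has_vector_derivative_cong_ev) (use assms in \<open>simp add: join_curves_def\<close>)
  then show ?thesis
    using has_vector_derivative_shift_iff[of \<rho> "- L" D s] by simp
qed

lemma differentiable_iff_vector:
  "f differentiable (at (s::real)) \<longleftrightarrow> (\<exists>D. (f has_vector_derivative D) (at s))"
  using vector_derivative_works differentiableI_vector by blast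

lemma unit_speed_curve_join:
  assumes \<sigma>: "unit_speed_curve L1 \<sigma>" and \<rho>: "unit_speed_curve L2 \<rho>" and meet: "\<sigma> L1 = \<rho> 0"
  shows "unit_speed_curve (L1 + L2) (join_curves L1 \<sigma> \<rho>)"
proof -
  obtain M1 where lip1: "M1-lipschitz_on {0..L1} \<sigma>"
    and ae1: "AE r in lebesgue. r \<in> {0<..<L1} \<longrightarrow>
        \<sigma> differentiable (at r) \<and> norm (vector_derivative \<sigma> (at r)) = 1"
    using \<sigma> by (auto simp: unit_speed_curve_def)
  obtain M2 where lip2: "M2-lipschitz_on {0..L2} \<rho>"
    and ae2: "AE r in lebesgue. r \<in> {0<..<L2} \<longrightarrow>
        \<rho> differentiable (at r) \<and> norm (vector_derivative \<rho> (at r)) = 1"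
    using \<rho> by (auto simp: unit_speed_curve_def)
  define M where "M = max M1 M2"
  have "M-lipschitz_on {0..L1} \<sigma>"
    by (rule lipschitz_on_le[OF lip1]) (simp add: M_def)
  moreover have "M-lipschitz_on {L1..L1 + L2} (\<lambda>s. \<rho> (s - L1))"
  proof (rule lipschitz_onI)
    fix x y assume "x \<in> {L1..L1 + L2}" "y \<in> {L1..L1 + L2}"
    then have "dist (\<rho> (x - L1)) (\<rho> (y - L1)) \<le> M2 * dist x y"
      using lipschitz_onD[OF lip2, of "x - L1" "y - L1"] by (auto simp: dist_real_def)
    also have "\<dots> \<le> M * dist x y" by (intro mult_right_mono) (auto simp: M_def)
    finally show "dist (\<rho> (x - L1)) (\<rho> (y - L1)) \<le> M * dist x y" .
  qed (use lipschitz_on_nonneg[OF lip1] in \<open>simp add: M_def\<close>)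
  ultimately have "M-lipschitz_on {0..L1 + L2} (join_curves L1 \<sigma> \<rho>)"
    unfolding join_curves_def using meet by (intro lipschitz_on_concat) auto
  moreover have "AE r in lebesgue. r \<in> {0<..<L1 + L2} \<longrightarrow>
      join_curves L1 \<sigma> \<rho> differentiable (at r) \<and>
      norm (vector_derivative (join_curves L1 \<sigma> \<rho>) (at r)) = 1"
    using ae1 AE_lebesgue_shift[OF ae2, of "- L1"] AE_lebesgue_neq[of L1]
  proof eventually_elim
    case (elim r)
    then consider "r < L1" | "L1 < r" by linarith
    then show ?case
    proof cases
      case 1
      with elim show ?thesis
        by (auto simp: differentiable_iff_vector vector_derivative_def
            has_vector_derivative_join_left)
    next
      case 2
      with elim show ?thesis
        by (auto simp: differentiable_iff_vector vector_derivative_def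
            has_vector_derivative_join_right)
    qed
  qed
  ultimately show ?thesis using \<sigma> \<rho> by (auto simp: unit_speed_curve_def)
qed

lemma unit_speed_segment:
  fixes x y :: "'a::euclidean_space"
  obtains \<rho> where "unit_speed_curve (dist x y) \<rho>" "\<rho> 0 = x" "\<rho> (dist x y) = y"
proof
  define v where "v = (y - x) /\<^sub>R dist x y"
  let ?\<rho> = "\<lambda>s. x + s *\<^sub>R v"
  show "?\<rho> 0 = x" by simp
  show "?\<rho> (dist x y) = y" by (cases "x = y") (simp_all add: v_def)
  have nv: "norm v = 1" if "x \<noteq> y"
    using that by (simp add: v_def dist_norm norm_minus_commute)
  have "norm v \<le> 1" using nv by (cases "x = y") (auto simp: v_def)
  then have "1-lipschitz_on {0..dist x y} ?\<rho>"
    by (intro lipschitz_onI) (auto simp: dist_norm scaleR_diff_left[symmetric] mult_left_le)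
  moreover have d: "(?\<rho> has_vector_derivative v) (at s)" for s
    by (auto intro!: derivative_eq_intros)
  have "?\<rho> differentiable (at s) \<and> norm (vector_derivative ?\<rho> (at s)) = 1"
    if "s \<in> {0<..<dist x y}" for s
  proof -
    have "x \<noteq> y" using that by auto
    with nv d[of s] show ?thesis by (auto simp: vector_derivative_at differentiableI_vector)
  qed
  ultimately show "unit_speed_curve (dist x y) ?\<rho>"
    by (auto simp: unit_speed_curve_def)
qed

lemma unit_speed_curve_point: "unit_speed_curve 0 (\<lambda>_. x)"
  by (auto simp: unit_speed_curve_def intro!: exI[of _ 0] lipschitz_onI)

section \<open>Cost of a curve\<close>

text \<open>
  The constants \<open>a\<close> and \<open>b\<close> are \<open>\<alpha>1\<close> and \<open>\<alpha>2\<close>: they are the extreme speeds of propagation.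
\<close>

locale eikonal =
  fixes a b :: real and H :: "'a::euclidean_space \<Rightarrow> 'a \<Rightarrow> real"
  assumes a_pos: "0 < a" and a_le_b: "a \<le> b" and admissible: "admissible_hamiltonian a b H"
begin

lemma b_pos: "0 < b"
  using a_pos a_le_b by simp

lemma fibre_bounds:
  shows "ball 0 (1 / b) \<subseteq> sublevel_fibre H x" and "sublevel_fibre H x \<subseteq> ball 0 (1 / a)"
proof -
  have "\<forall>x. ball 0 (1 / b) \<subseteq> sublevel_fibre H x \<and> sublevel_fibre H x \<subseteq> ball 0 (1 / a)"
    using admissible unfolding admissible_hamiltonian_def by (elim conjE)
  then show "ball 0 (1 / b) \<subseteq> sublevel_fibre H x" "sublevel_fibre H x \<subseteq> ball 0 (1 / a)"
    by simp_all
qed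

lemma zero_in_fibre: "0 \<in> sublevel_fibre H x"
  using fibre_bounds(1)[of x] b_pos by auto

lemma compact_fibre: "compact (sublevel_fibre H x)"
proof -
  have "sublevel_fibre H x = Pair x -` sublevel_graph H"
    by (auto simp: sublevel_fibre_def sublevel_graph_def)
  moreover have "closed (sublevel_graph H)"
    using admissible by (simp add: admissible_hamiltonian_def)
  ultimately have "closed (sublevel_fibre H x)"
    by (simp add: continuous_closed_vimage continuous_Pair)
  moreover have "bounded (sublevel_fibre H x)"
    using fibre_bounds(2) bounded_ball bounded_subset by blast
  ultimately show ?thesis by (simp add: compact_eq_bounded_closed)
qed

lemma norm_fibre_le: "p \<in> sublevel_fibre H x \<Longrightarrow> norm p \<le> 1 / a"
  using fibre_bounds(2)[of x] by auto

lemma pairing_le: "p \<in> sublevel_fibre H x \<Longrightarrow> - (p \<bullet> v) \<le> norm v / a"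
proof -
  assume p: "p \<in> sublevel_fibre H x"
  have "- (p \<bullet> v) \<le> norm p * norm v"
    using norm_cauchy_schwarz[of "- p" v] by simp
  also have "\<dots> \<le> 1 / a * norm v"
    by (intro mult_right_mono norm_fibre_le[OF p]) auto
  finally show ?thesis by simp
qed

lemma support_function_ge: "p \<in> sublevel_fibre H x \<Longrightarrow> - (p \<bullet> v) \<le> support_function H x v"
  unfolding support_function_def
  by (rule cSUP_upper) (auto intro!: bdd_aboveI2 pairing_le)

lemma support_function_le: "support_function H x v \<le> norm v / a"
  unfolding support_function_def
  by (rule cSUP_least) (use zero_in_fibre in \<open>auto intro: pairing_le\<close>)

text \<open>
  Test the supremum with \<open>p = - c v / |v|\<close> and let \<open>c\<close> increase to \<open>1 / b\<close>.
\<close>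

lemma support_function_lower: "norm v / b \<le> support_function H x v"
proof (cases "v = 0")
  case True
  then show ?thesis using support_function_ge[OF zero_in_fibre, of v x] by simp
next
  case False
  have "c * norm v \<le> support_function H x v" if "0 < c" "c < 1 / b" for c
  proof -
    have "- (c / norm v) *\<^sub>R v \<in> ball 0 (1 / b)"
      using that False by simp
    then have "- (c / norm v) *\<^sub>R v \<in> sublevel_fibre H x"
      by (rule subsetD[OF fibre_bounds(1)])
    then have "- ((- (c / norm v) *\<^sub>R v) \<bullet> v) \<le> support_function H x v"
      by (rule support_function_ge)
    moreover have "- ((- (c / norm v) *\<^sub>R v) \<bullet> v) = c * norm v"
      using False by (simp add: dot_square_norm power2_eq_square)
    ultimately show ?thesis by (simp only:)
  qed
  then have "\<And>c. 0 < c \<Longrightarrow> c < 1 / b \<Longrightarrow> c \<le> support_function H x v / norm v"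
    using False by (simp add: pos_le_divide_eq)
  then have "1 / b \<le> support_function H x v / norm v"
    by (rule dense_le_bounded[of 0, rotated]) (use b_pos in simp_all)
  then show ?thesis using False by (simp add: pos_le_divide_eq)
qed

lemma support_function_attained:
  obtains p where "p \<in> sublevel_fibre H x" "support_function H x v = - (p \<bullet> v)"
proof -
  have "continuous_on (sublevel_fibre H x) (\<lambda>p. - (p \<bullet> v))"
    by (intro continuous_intros)
  moreover have "sublevel_fibre H x \<noteq> {}" using zero_in_fibre[of x] by force
  ultimately obtain p where p: "p \<in> sublevel_fibre H x"
    "\<And>q. q \<in> sublevel_fibre H x \<Longrightarrow> - (q \<bullet> v) \<le> - (p \<bullet> v)"
    using continuous_attains_sup[OF compact_fibre, of x "\<lambda>p. - (p \<bullet> v)"] by metis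
  have "support_function H x v \<le> - (p \<bullet> v)"
    unfolding support_function_def
    by (rule cSUP_least) (use p in auto)
  then show thesis
    using p(1) support_function_ge[OF p(1), of v] by (intro that[of p]) auto
qed

text \<open>
  The support function is jointly upper semicontinuous although \<open>H\<close> may be discontinuous: its
  superlevel sets are projections of closed sets along a compact ball of momenta.
\<close>

lemma closed_support_function_superlevel:
  "closed {(x, v). c \<le> support_function H x v}"
proof -
  define T where "T = {(p, x, v). (x, p) \<in> sublevel_graph H \<and> c \<le> - (p \<bullet> v)}"
  have graph: "closed (sublevel_graph H)"
    using admissible by (simp add: admissible_hamiltonian_def)
  have "T = ((\<lambda>z. (fst (snd z), fst z)) -` sublevel_graph H) \<inter> {z. c \<le> - (fst z \<bullet> snd (snd z))}"
    by (auto simp: T_def)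
  also have "closed \<dots>"
    by (intro closed_Int continuous_closed_vimage[OF graph] closed_Collect_le)
       (auto intro!: continuous_intros)
  finally have "closed {y. \<exists>p. p \<in> cball 0 (1 / a) \<and> (p, y) \<in> T}"
    by (intro closed_compact_projection) auto
  also have "{y. \<exists>p. p \<in> cball 0 (1 / a) \<and> (p, y) \<in> T} = {(x, v). c \<le> support_function H x v}"
  proof (intro equalityI subsetI; clarify)
    fix x v p assume "(p, x, v) \<in> T"
    then show "c \<le> support_function H x v"
      using support_function_ge[of p x v]
      by (auto simp: T_def sublevel_graph_def sublevel_fibre_def)
  next
    fix x v assume c: "c \<le> support_function H x v"
    obtain p where "p \<in> sublevel_fibre H x" "support_function H x v = - (p \<bullet> v)"
      by (rule support_function_attained)
    with c norm_fibre_le[of p x] show "\<exists>p. p \<in> cball 0 (1 / a) \<and> (p, x, v) \<in> T"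
      by (auto simp: T_def sublevel_graph_def sublevel_fibre_def)
  qed
  finally show ?thesis .
qed

lemma borel_measurable_support_function:
  assumes "f \<in> borel_measurable M" "g \<in> borel_measurable M"
  shows "(\<lambda>s. support_function H (f s) (g s)) \<in> borel_measurable M"
proof -
  have "(\<lambda>z. support_function H (fst z) (snd z)) \<in> borel_measurable borel"
    unfolding borel_measurable_iff_ge
  proof
    fix c
    have "{w \<in> space borel. c \<le> support_function H (fst w) (snd w)} = {(x, v). c \<le> support_function H x v}"
      by auto
    then show "{w \<in> space borel. c \<le> support_function H (fst w) (snd w)} \<in> sets borel"
      using closed_support_function_superlevel[of c] by simp
  qed
  moreover have "(\<lambda>s. (f s, g s)) \<in> borel_measurable M"
    using borel_measurable_Pair[OF assms] .
  ultimately have "(\<lambda>s. support_function H (fst (f s, g s)) (snd (f s, g s))) \<in> borel_measurable M"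
    by (rule measurable_compose[rotated])
  then show ?thesis by simp
qed

abbreviation integrand :: "(real \<Rightarrow> 'a) \<Rightarrow> real \<Rightarrow> real" where
  "integrand \<rho> s \<equiv> support_function H (\<rho> s) (vector_derivative \<rho> (at s))"

lemma integrand_bounds:
  assumes "unit_speed_curve L \<rho>"
  shows "AE s in lebesgue. s \<in> {0<..<L} \<longrightarrow> 1 / b \<le> integrand \<rho> s \<and> integrand \<rho> s \<le> 1 / a"
proof -
  show ?thesis
    using unit_speed_curveD(4)[OF assms]
  proof eventually_elim
    case (elim s)
    then show ?case
      using support_function_le[of "\<rho> s" "vector_derivative \<rho> (at s)"]
        support_function_lower[of "vector_derivative \<rho> (at s)" "\<rho> s"] by auto
  qed
qed

text \<open>
  Measurability matters here: the integral of a function that is not integrable is \<open>0\<close> by convention,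
  and the lower bound on the cost would fail.
\<close>

lemma integrand_integrable:
  assumes "unit_speed_curve L \<rho>"
  shows "set_integrable lebesgue {0..L} (integrand \<rho>)"
proof -
  note L = unit_speed_curveD(1)[OF assms] and diff = unit_speed_curveD(3)[OF assms]
  obtain M where lip: "M-lipschitz_on {0..L} \<rho>"
    using unit_speed_curveD(2)[OF assms] by blast
  define F where "F = (\<lambda>s. \<rho> (max 0 (min L s)))"
  have "continuous_on UNIV F"
    unfolding F_def by (rule lipschitz_on_continuous_on[OF lipschitz_clamp[OF lip L]])
  then have F: "F \<in> borel_measurable lebesgue"
    by (simp add: borel_measurable_continuous_onI measurable_completion)
  define D where "D s = indicator {0<..<L} s *\<^sub>R vector_derivative \<rho> (at s)" for s
  have D: "D \<in> borel_measurable lebesgue"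
    unfolding D_def by (rule lipschitz_derivative_integral(1)[OF lip L diff])
  have "(\<lambda>s. indicator {0..L} s * support_function H (F s) (D s)) \<in> borel_measurable lebesgue"
    by (intro borel_measurable_times borel_measurable_support_function F D borel_measurable_indicator)
       simp
  moreover have "AE s in lebesgue. indicator {0..L} s * support_function H (F s) (D s)
      = indicator {0..L} s *\<^sub>R integrand \<rho> s"
    using AE_lebesgue_neq[of 0] AE_lebesgue_neq[of L]
    by eventually_elim (auto simp: F_def D_def indicator_def)
  ultimately have meas: "(\<lambda>s. indicator {0..L} s *\<^sub>R integrand \<rho> s) \<in> borel_measurable lebesgue"
    by (rule borel_measurable_AE)
  have bd: "AE s in lebesgue. norm (indicator {0..L} s *\<^sub>R integrand \<rho> s)
      \<le> norm (indicator {0..L} s * (1 / a))"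
    using integrand_bounds[OF assms] AE_lebesgue_neq[of 0] AE_lebesgue_neq[of L]
  proof eventually_elim
    case (elim s)
    have "\<bar>integrand \<rho> s\<bar> \<le> 1 / a" if "s \<in> {0..L}"
    proof -
      have "1 / b \<le> integrand \<rho> s" "integrand \<rho> s \<le> 1 / a" using elim that by auto
      moreover have "0 < 1 / b" using b_pos by simp
      ultimately show ?thesis by linarith
    qed
    with a_pos show ?case by (auto simp: indicator_def)
  qed
  have "integrable lebesgue (\<lambda>s. indicator {0..L} s * (1 / a) :: real)"
    using L by (intro integrable_mult_left integrable_real_indicator) simp_all
  then show ?thesis
    unfolding set_integrable_def by (rule Bochner_Integration.integrable_bound[OF _ meas bd])
qed

lemma set_integrand_integrable:
  assumes "unit_speed_curve L \<rho>" "0 \<le> s" "t \<le> L"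
  shows "set_integrable lebesgue {s..t} (integrand \<rho>)"
  by (rule set_integrable_subset[OF integrand_integrable[OF assms(1)]]) (use assms in auto)

text \<open>
  The two-sided rate of cost per unit length, on which all estimates for the solution rest.
\<close>

lemma partial_cost_bounds:
  assumes "unit_speed_curve L \<rho>" "0 \<le> s" "s \<le> t" "t \<le> L"
  shows "(t - s) / b \<le> (LINT r:{s..t}|lebesgue. integrand \<rho> r)"
    and "(LINT r:{s..t}|lebesgue. integrand \<rho> r) \<le> (t - s) / a"
proof -
  have const: "set_integrable lebesgue {s..t} (\<lambda>_. c :: real)"
    and val: "(LINT r:{s..t}|lebesgue. c) = (t - s) * c" for c
    using \<open>s \<le> t\<close> by (simp_all add: set_integrable_def set_lebesgue_integral_def)
  have "AE r in lebesgue. r \<in> {s..t} \<longrightarrow> 1 / b \<le> integrand \<rho> r \<and> integrand \<rho> r \<le> 1 / a"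
    using integrand_bounds[OF assms(1)] AE_lebesgue_neq[of 0] AE_lebesgue_neq[of L]
    by eventually_elim (use assms in auto)
  then have "AE r\<in>{s..t} in lebesgue. 1 / b \<le> integrand \<rho> r"
    "AE r\<in>{s..t} in lebesgue. integrand \<rho> r \<le> 1 / a"
    by (eventually_elim, simp)+
  with val show "(t - s) / b \<le> (LINT r:{s..t}|lebesgue. integrand \<rho> r)"
    "(LINT r:{s..t}|lebesgue. integrand \<rho> r) \<le> (t - s) / a"
    using set_integral_mono_AE[OF const set_integrand_integrable[OF assms(1,2,4)], of "1 / b"]
      set_integral_mono_AE[OF set_integrand_integrable[OF assms(1,2,4)] const, of "1 / a"]
    by auto
qed

lemma partial_cost_split:
  assumes "unit_speed_curve L \<rho>" "0 \<le> s" "s \<le> t" "t \<le> r" "r \<le> L"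
  shows "(LINT q:{s..r}|lebesgue. integrand \<rho> q) =
    (LINT q:{s..t}|lebesgue. integrand \<rho> q) + (LINT q:{t..r}|lebesgue. integrand \<rho> q)"
proof -
  have "{s..r} = {s..t} \<union> {t..r}" using assms by auto
  moreover have "(LINT q:{s..t}\<union>{t..r}|lebesgue. integrand \<rho> q) =
    (LINT q:{s..t}|lebesgue. integrand \<rho> q) + (LINT q:{t..r}|lebesgue. integrand \<rho> q)"
  proof (rule set_integral_Un_AE)
    show "AE q in lebesgue. \<not> (q \<in> {s..t} \<and> q \<in> {t..r})"
      using AE_lebesgue_neq[of t] by eventually_elim auto
  qed (use assms in \<open>auto intro!: set_integrand_integrable\<close>)
  ultimately show ?thesis by simp
qed

lemma curve_cost_join:
  assumes \<sigma>: "unit_speed_curve L1 \<sigma>" and \<rho>: "unit_speed_curve L2 \<rho>" and meet: "\<sigma> L1 = \<rho> 0"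
  shows "curve_cost H (L1 + L2) (join_curves L1 \<sigma> \<rho>) = curve_cost H L1 \<sigma> + curve_cost H L2 \<rho>"
proof -
  let ?j = "join_curves L1 \<sigma> \<rho>"
  have L: "0 \<le> L1" "0 \<le> L2" using \<sigma> \<rho> by (auto simp: unit_speed_curve_def)
  have "curve_cost H (L1 + L2) ?j = (LINT s:{0..L1}|lebesgue. integrand ?j s) +
      (LINT s:{L1..L1 + L2}|lebesgue. integrand ?j s)"
    unfolding curve_cost_def
    by (rule partial_cost_split[OF unit_speed_curve_join[OF assms]]) (use L in auto)
  also have "(LINT s:{0..L1}|lebesgue. integrand ?j s) = curve_cost H L1 \<sigma>"
    unfolding curve_cost_def
    by (intro set_integral_cong_interior)
       (simp add: vector_derivative_def has_vector_derivative_join_left, simp add: join_curves_def)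
  also have "(LINT s:{L1..L1 + L2}|lebesgue. integrand ?j s)
      = curve_cost H (L1 + L2 - L1) (\<lambda>s. ?j (L1 + s))"
    by (rule curve_cost_shift[symmetric])
  also have "\<dots> = curve_cost H L2 \<rho>"
  proof -
    have "curve_cost H L2 (\<lambda>s. ?j (L1 + s)) = curve_cost H L2 \<rho>"
      unfolding curve_cost_def vector_derivative_shift
      by (intro set_integral_cong_interior)
       (simp add: vector_derivative_def has_vector_derivative_join_right, simp add: join_curves_def)
    then show ?thesis by simp
  qed
  finally show ?thesis .
qed

lemma curve_cost_lower:
  assumes "unit_speed_curve L \<rho>"
  shows "L / b \<le> curve_cost H L \<rho>"
  using partial_cost_bounds(1)[OF assms, of 0 L] unit_speed_curveD(1)[OF assms]
  by (simp add: curve_cost_def)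

lemma curve_cost_upper:
  assumes "unit_speed_curve L \<rho>"
  shows "curve_cost H L \<rho> \<le> L / a"
  using partial_cost_bounds(2)[OF assms, of 0 L] unit_speed_curveD(1)[OF assms]
  by (simp add: curve_cost_def)

lemma curve_cost_nonneg:
  assumes "unit_speed_curve L \<rho>"
  shows "0 \<le> curve_cost H L \<rho>"
proof -
  have "0 \<le> L / b" using unit_speed_curveD(1)[OF assms] b_pos by simp
  then show ?thesis using curve_cost_lower[OF assms] by linarith
qed

lemma eikonal_solution_le_cost:
  assumes "unit_speed_curve L \<rho>" "\<rho> L \<in> K"
  shows "eikonal_solution H K (\<rho> 0) \<le> curve_cost H L \<rho>"
  unfolding eikonal_solution_def
proof (rule cInf_lower)
  show "bdd_below {curve_cost H L' \<rho>' |L' \<rho>'. unit_speed_curve L' \<rho>' \<and> \<rho>' 0 = \<rho> 0 \<and> \<rho>' L' \<in> K}"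
    by (rule bdd_belowI[of _ 0]) (auto intro: curve_cost_nonneg)
  show "curve_cost H L \<rho> \<in> {curve_cost H L' \<rho>' |L' \<rho>'. unit_speed_curve L' \<rho>' \<and> \<rho>' 0 = \<rho> 0 \<and> \<rho>' L' \<in> K}"
    by (intro CollectI exI[of _ L] exI[of _ \<rho>] conjI refl assms)
qed

text \<open>
  The tail of \<open>\<rho>\<close> competes in the infimum at \<open>\<rho> s\<close>, and the part before \<open>s\<close> has cost at least \<open>s / b\<close>.
\<close>

lemma eikonal_solution_le_cost_tail:
  assumes \<rho>: "unit_speed_curve L \<rho>" "\<rho> L \<in> K" and s: "0 \<le> s" "s \<le> L"
  shows "eikonal_solution H K (\<rho> s) + s / b \<le> curve_cost H L \<rho>"
proof -
  have "eikonal_solution H K (\<rho> (s + 0)) \<le> curve_cost H (L - s) (\<lambda>r. \<rho> (s + r))"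
    using eikonal_solution_le_cost[OF unit_speed_curve_shift[OF \<rho>(1) s], of K] \<rho>(2) by simp
  also have "\<dots> = (LINT r:{s..L}|lebesgue. integrand \<rho> r)"
    by (rule curve_cost_shift)
  finally show ?thesis
    using partial_cost_split[OF \<rho>(1), of 0 s L] partial_cost_bounds(1)[OF \<rho>(1), of 0 s] s
    by (simp add: curve_cost_def)
qed

end

section \<open>John domains\<close>

lemma ball_infdist_frontier_subset:
  fixes S :: "'a::real_normed_vector set"
  assumes "y \<in> S"
  shows "ball y (infdist y (frontier S)) \<subseteq> S"
proof (rule ccontr)
  assume "\<not> ?thesis"
  then obtain w where "w \<in> ball y (infdist y (frontier S))" "w \<notin> S" by blast
  then have w: "dist y w < infdist y (frontier S)" "w \<notin> S" by simp_all
  from w(1) have "0 < infdist y (frontier S)" by (rule le_less_trans[OF zero_le_dist])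
  then have "ball y (infdist y (frontier S)) \<inter> S \<noteq> {}"
    using assms centre_in_ball by blast
  moreover have "ball y (infdist y (frontier S)) - S \<noteq> {}"
    using w mem_ball by blast
  ultimately have "ball y (infdist y (frontier S)) \<inter> frontier S \<noteq> {}"
    by (rule connected_Int_frontier[OF connected_ball])
  then obtain z where "z \<in> frontier S" "dist y z < infdist y (frontier S)" by auto
  then show False using infdist_le[of z "frontier S" y] by simp
qed

lemma john_domain_curve:
  assumes "john_domain U x0 \<kappa>" "x \<in> U"
  obtains L \<gamma> where "unit_speed_curve L \<gamma>" "\<gamma> ` {0..L} \<subseteq> U" "\<gamma> 0 = x" "\<gamma> L = x0"
    "\<And>q. q \<in> {0..L} \<Longrightarrow> \<kappa> * q \<le> infdist (\<gamma> q) (frontier U)"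
proof -
  have "\<exists>L \<gamma>. unit_speed_curve L \<gamma> \<and> \<gamma> ` {0..L} \<subseteq> U \<and> \<gamma> 0 = x \<and> \<gamma> L = x0 \<and>
      (\<forall>q\<in>{0..L}. \<kappa> * q \<le> infdist (\<gamma> q) (frontier U))"
    using assms by (simp add: john_domain_def)
  then obtain L \<gamma> where "unit_speed_curve L \<gamma> \<and> \<gamma> ` {0..L} \<subseteq> U \<and> \<gamma> 0 = x \<and> \<gamma> L = x0 \<and>
      (\<forall>q\<in>{0..L}. \<kappa> * q \<le> infdist (\<gamma> q) (frontier U))"
    by (elim exE)
  then show thesis by (intro that[of L \<gamma>]) simp_all
qed

section \<open>Volume of porous sets\<close>

lemma emeasure_ball_scale:
  fixes c d :: "'a::euclidean_space"
  assumes "0 \<le> M" "0 \<le> r"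
  shows "emeasure lborel (ball c (M * r)) = ennreal (M ^ DIM('a)) * emeasure lborel (ball d r)"
proof -
  have "emeasure lborel (ball e s) = ennreal (measure lborel (ball e s))" for e :: 'a and s
    using emeasure_lborel_ball_finite[of e s] by (intro emeasure_eq_ennreal_measure) auto
  moreover have "measure lborel (ball c (M * r)) = M ^ DIM('a) * measure lborel (ball d r)"
    using assms content_ball_conv_unit_ball[of "M * r" c] content_ball_conv_unit_ball[of r d]
    by (simp add: power_mult_distrib)
  ultimately show ?thesis
    using assms by (simp add: ennreal_mult)
qed

text \<open>
  Double counting. Integrate the indicator of the pairs \<open>(x, y)\<close> with \<open>x \<in> A\<close>, \<open>y \<in> G\<close> and
  \<open>dist x y < M \<rho>\<close>. Over \<open>y\<close> first, each \<open>x\<close> contributes at least the volume of a ball of radius \<open>\<rho>\<close>; over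
  \<open>x\<close> first, each \<open>y\<close> contributes at most the volume of a ball of radius \<open>M \<rho>\<close>.
\<close>

lemma emeasure_le_of_nearby_balls:
  fixes A G :: "'a::euclidean_space set"
  assumes [measurable]: "A \<in> sets borel" "G \<in> sets borel"
    and \<rho>: "0 < \<rho>" and M: "0 \<le> M"
    and near: "\<And>x. x \<in> A \<Longrightarrow> \<exists>y. ball y \<rho> \<subseteq> ball x (M * \<rho>) \<inter> G"
  shows "emeasure lborel A \<le> ennreal (M ^ DIM('a)) * emeasure lborel G"
proof -
  define w where "w = emeasure lborel (ball (0::'a) \<rho>)"
  define W where "W = {z :: 'a \<times> 'a. dist (fst z) (snd z) < M * \<rho>}"
  have [measurable]: "W \<in> sets borel"
    unfolding W_def by (intro borel_open open_Collect_less continuous_intros)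
  have ball_w: "emeasure lborel (ball y \<rho>) = w" for y :: 'a
    using emeasure_ball_scale[of 1 \<rho> y 0] \<rho> by (simp add: w_def)
  have ball_Mw: "emeasure lborel (ball y (M * \<rho>)) = ennreal (M ^ DIM('a)) * w" for y :: 'a
    using emeasure_ball_scale[of M \<rho> y 0] \<rho> M by (simp add: w_def)
  define f :: "'a \<Rightarrow> 'a \<Rightarrow> ennreal" where
    "f x y = indicator A x * indicator G y * indicator W (x, y)" for x y
  have [measurable]: "W \<in> sets (lborel \<Otimes>\<^sub>M lborel)"
    unfolding lborel_prod by simp
  have f_meas: "case_prod f \<in> borel_measurable (lborel \<Otimes>\<^sub>M lborel)"
    unfolding f_def by measurable
  have "w * emeasure lborel A = (\<integral>\<^sup>+x. w * indicator A x \<partial>lborel)"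
    by (simp add: nn_integral_cmult_indicator)
  also have "\<dots> \<le> (\<integral>\<^sup>+x. (\<integral>\<^sup>+y. f x y \<partial>lborel) \<partial>lborel)"
  proof (rule nn_integral_mono)
    fix x :: 'a
    show "w * indicator A x \<le> (\<integral>\<^sup>+y. f x y \<partial>lborel)"
    proof (cases "x \<in> A")
      case True
      from near[OF True] obtain y where y: "ball y \<rho> \<subseteq> ball x (M * \<rho>) \<inter> G" ..
      have "w = (\<integral>\<^sup>+z. indicator (ball y \<rho>) z \<partial>lborel)"
        by (simp add: ball_w)
      also have "\<dots> \<le> (\<integral>\<^sup>+z. f x z \<partial>lborel)"
        using y True by (intro nn_integral_mono) (auto simp: f_def W_def indicator_def)
      finally show ?thesis using True by simp
    qed simp
  qed
  also have "\<dots> = (\<integral>\<^sup>+y. (\<integral>\<^sup>+x. f x y \<partial>lborel) \<partial>lborel)"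
    by (rule lborel_pair.Fubini'[OF f_meas, symmetric])
  also have "\<dots> \<le> (\<integral>\<^sup>+y. (ennreal (M ^ DIM('a)) * w) * indicator G y \<partial>lborel)"
  proof (rule nn_integral_mono)
    fix y :: 'a
    show "(\<integral>\<^sup>+x. f x y \<partial>lborel) \<le> (ennreal (M ^ DIM('a)) * w) * indicator G y"
    proof (cases "y \<in> G")
      case True
      have "(\<integral>\<^sup>+x. f x y \<partial>lborel) \<le> (\<integral>\<^sup>+x. indicator (ball y (M * \<rho>)) x \<partial>lborel)"
        by (intro nn_integral_mono) (auto simp: f_def W_def indicator_def dist_commute)
      then show ?thesis using True by (simp add: ball_Mw)
    qed (simp add: f_def)
  qed
  also have "\<dots> = w * (ennreal (M ^ DIM('a)) * emeasure lborel G)"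
    by (subst nn_integral_cmult_indicator) (simp_all add: mult_ac)
  finally have "w * emeasure lborel A \<le> w * (ennreal (M ^ DIM('a)) * emeasure lborel G)" .
  moreover have "w \<noteq> 0" "w \<noteq> top"
    using content_ball_pos[OF \<rho>, of "0::'a"] emeasure_lborel_ball_finite[of "0::'a" \<rho>]
    by (auto simp: w_def measure_def)
  ultimately show ?thesis
    by (simp add: ennreal_mult_le_mult_iff)
qed

definition thickening :: "real \<Rightarrow> 'a::metric_space set \<Rightarrow> 'a set" where
  "thickening \<rho> E = (\<Union>e\<in>E. ball e \<rho>)"

definition porous_at_scale :: "real \<Rightarrow> real \<Rightarrow> 'a::metric_space set \<Rightarrow> bool" where
  "porous_at_scale k s E \<longleftrightarrow> (\<forall>x\<in>E. \<exists>y. dist x y \<le> s \<and> ball y (k * s) \<inter> E = {})"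

lemma open_thickening: "open (thickening \<rho> E)"
  by (auto simp: thickening_def)

text \<open>
  At scale \<open>s = 2 \<rho> / k\<close> the holes of \<open>E\<close> have radius \<open>k s = 2 \<rho>\<close>. The concentric ball of radius \<open>\<rho>\<close>
  therefore misses the \<open>\<rho>\<close>-thickening, while all of it is within \<open>s + 2 \<rho> \<le> 2 s = (4 / k) \<rho>\<close> of the
  given point.
\<close>

lemma emeasure_thickening_gap:
  fixes E :: "'a::euclidean_space set"
  assumes k: "0 < k" "k \<le> 1" and \<rho>: "0 < \<rho>" and porous: "porous_at_scale k (2 * \<rho> / k) E"
  shows "emeasure lborel (thickening \<rho> E) \<le>
    ennreal ((4 / k) ^ DIM('a)) * emeasure lborel (thickening (4 / k * \<rho>) E - thickening \<rho> E)"
proof (rule emeasure_le_of_nearby_balls[OF _ _ \<rho>])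
  show "thickening \<rho> E \<in> sets borel" "thickening (4 / k * \<rho>) E - thickening \<rho> E \<in> sets borel"
    by (intro sets.Diff borel_open open_thickening)+
  show "0 \<le> 4 / k" using k by simp
  fix x assume "x \<in> thickening \<rho> E"
  then obtain e where e: "e \<in> E" "dist e x < \<rho>" by (auto simp: thickening_def)
  define s where "s = 2 * \<rho> / k"
  have s: "k * s = 2 * \<rho>" "4 / k * \<rho> = 2 * s" using k by (auto simp: s_def)
  have "2 * \<rho> \<le> s" using k \<rho> by (simp add: s_def field_simps)
  obtain y where y: "dist e y \<le> s" "ball y (k * s) \<inter> E = {}"
    using porous e(1) by (auto simp: porous_at_scale_def s_def)
  have "ball y \<rho> \<subseteq> ball x (4 / k * \<rho>) \<inter> (thickening (4 / k * \<rho>) E - thickening \<rho> E)"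
  proof
    fix w assume "w \<in> ball y \<rho>"
    then have w: "dist y w < \<rho>" by simp
    have "dist e w < s + \<rho>"
      using dist_triangle[of e w y] y(1) w by simp
    moreover from this have "dist x w < 2 * s"
      using dist_triangle[of x w e] e(2) \<open>2 * \<rho> \<le> s\<close> by (simp add: dist_commute)
    moreover have "w \<notin> thickening \<rho> E"
    proof
      assume "w \<in> thickening \<rho> E"
      then obtain e' where e': "e' \<in> E" "dist e' w < \<rho>" by (auto simp: thickening_def)
      then have "dist y e' < k * s"
        using dist_triangle[of y e' w] w s(1) by (simp add: dist_commute)
      with e'(1) y(2) show False by auto
    qed
    ultimately show "w \<in> ball x (4 / k * \<rho>) \<inter> (thickening (4 / k * \<rho>) E - thickening \<rho> E)"
      using e(1) \<open>2 * \<rho> \<le> s\<close> \<rho> unfolding s(2) by (auto simp: thickening_def intro!: bexI[of _ e])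
  qed
  then show "\<exists>y. ball y \<rho> \<subseteq> ball x (4 / k * \<rho>) \<inter> (thickening (4 / k * \<rho>) E - thickening \<rho> E)"
    by blast
qed

text \<open>
  With \<open>m\<close> and \<open>m'\<close> the volumes of the small and the large thickening, the gap estimate reads
  \<open>m \<le> N (m' - m)\<close>; solving for \<open>m\<close> yields a contraction factor below \<open>1\<close>.
\<close>

lemma measure_thickening_contracts:
  fixes E :: "'a::euclidean_space set"
  assumes k: "0 < k" "k \<le> 1" and \<rho>: "0 < \<rho>" and porous: "porous_at_scale k (2 * \<rho> / k) E"
    and bnd: "bounded E"
  defines "N \<equiv> (4 / k) ^ DIM('a)"
  shows "measure lborel (thickening \<rho> E) \<le> N / (1 + N) * measure lborel (thickening (4 / k * \<rho>) E)"
proof -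
  have N: "0 < N" using k by (simp add: N_def)
  obtain R x where R: "E \<subseteq> cball x R" using bnd bounded_subset_cball by blast
  have fin: "emeasure lborel (thickening r E) < \<infinity>" for r
  proof -
    have "thickening r E \<subseteq> ball x (R + r)"
    proof
      fix w assume "w \<in> thickening r E"
      then obtain e where "e \<in> E" "dist e w < r" by (auto simp: thickening_def)
      with R show "w \<in> ball x (R + r)" using dist_triangle[of x w e] by force
    qed
    then have "emeasure lborel (thickening r E) \<le> emeasure lborel (ball x (R + r))"
      by (intro emeasure_mono) auto
    then show ?thesis using emeasure_lborel_ball_finite[of x "R + r"] by (simp add: order_le_less_trans)
  qed
  have meas: "thickening r E \<in> sets lborel" for r
    by (simp add: borel_open open_thickening)
  have "1 * \<rho> \<le> 4 / k * \<rho>" using k \<rho> by (intro mult_right_mono) auto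
  then have sub: "thickening \<rho> E \<subseteq> thickening (4 / k * \<rho>) E"
    by (force simp: thickening_def)
  have emeas: "emeasure lborel (thickening r E) = ennreal (measure lborel (thickening r E))" for r
    using fin[of r] by (intro emeasure_eq_ennreal_measure) auto
  have "emeasure lborel (thickening (4 / k * \<rho>) E - thickening \<rho> E) =
      ennreal (measure lborel (thickening (4 / k * \<rho>) E) - measure lborel (thickening \<rho> E))"
    using sub fin[of \<rho>] meas by (subst emeasure_Diff) (auto simp: emeas ennreal_minus)
  then have "ennreal (measure lborel (thickening \<rho> E)) \<le>
      ennreal (N * (measure lborel (thickening (4 / k * \<rho>) E) - measure lborel (thickening \<rho> E)))"
    using emeasure_thickening_gap[OF k \<rho> porous] N
    by (simp add: emeas N_def[symmetric] ennreal_mult')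
  moreover have "measure lborel (thickening \<rho> E) \<le> measure lborel (thickening (4 / k * \<rho>) E)"
    using emeasure_mono[OF sub meas] by (simp add: emeas)
  ultimately have "measure lborel (thickening \<rho> E) \<le>
      N * (measure lborel (thickening (4 / k * \<rho>) E) - measure lborel (thickening \<rho> E))"
    using N by (simp add: ennreal_le_iff)
  then show ?thesis using N by (simp add: field_simps)
qed

text \<open>
  The exponent is chosen such that one step of the recursion reproduces the claimed bound exactly:
  \<open>q * (M * \<rho>) powr \<mu> = \<rho> powr \<mu>\<close>.
\<close>

lemma geometric_decay_powr:
  fixes f :: "real \<Rightarrow> real"
  assumes M: "1 < M" and q: "0 < q" and \<mu>: "M powr \<mu> * q = 1" "0 \<le> \<mu>"
    and D: "0 < D" and V: "0 \<le> V"
    and le: "\<And>\<rho>. \<rho> \<le> M * D \<Longrightarrow> f \<rho> \<le> V"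
    and step: "\<And>\<rho>. \<epsilon> \<le> \<rho> \<Longrightarrow> \<rho> \<le> D \<Longrightarrow> f \<rho> \<le> q * f (M * \<rho>)"
    and \<rho>: "0 < \<rho>" "\<epsilon> \<le> \<rho>" "\<rho> \<le> M * D"
  shows "f \<rho> \<le> V * (\<rho> / D) powr \<mu>"
proof -
  obtain m where "D / \<rho> < M ^ m" using real_arch_pow[OF M] by blast
  then have "D < M ^ m * \<rho>" using \<rho> by (simp add: field_simps)
  then show ?thesis using \<rho>
  proof (induction m arbitrary: \<rho>)
    case 0
    then have "1 \<le> (\<rho> / D) powr \<mu>" using D \<mu> by (intro ge_one_powr_ge_zero) auto
    then have "V * 1 \<le> V * (\<rho> / D) powr \<mu>" using V by (intro mult_left_mono) auto
    then show ?case using le[of \<rho>] 0 by simp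
  next
    case (Suc m)
    show ?case
    proof (cases "\<rho> \<le> D")
      case True
      have "\<rho> \<le> M * \<rho>" using M Suc.prems by simp
      then have "f (M * \<rho>) \<le> V * (M * \<rho> / D) powr \<mu>"
        using Suc.prems(1,2) order_trans[OF Suc.prems(3) \<open>\<rho> \<le> M * \<rho>\<close>] M True
        by (intro Suc.IH) (simp_all add: mult_ac)
      then have "f \<rho> \<le> q * (V * (M * \<rho> / D) powr \<mu>)"
        using step[OF Suc.prems(3) True] q by (meson mult_left_mono order_trans less_imp_le)
      also have "\<dots> = (M powr \<mu> * q) * (V * (\<rho> / D) powr \<mu>)"
        using M Suc.prems D by (simp add: powr_mult powr_divide)
      finally show ?thesis using \<mu> by simp
    next
      case False
      then have "1 \<le> (\<rho> / D) powr \<mu>" using D \<mu> by (intro ge_one_powr_ge_zero) auto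
      then have "V * 1 \<le> V * (\<rho> / D) powr \<mu>" using V by (intro mult_left_mono) auto
      then show ?thesis using le[of \<rho>] Suc by simp
    qed
  qed
qed

text \<open>
  Porosity down to scale \<open>4 \<epsilon>\<close> forces power decay of the volume in \<open>\<epsilon>\<close>, with constants that depend on
  the dimension, the porosity constant, the largest porous scale and the diameter only.
\<close>

lemma porous_volume_bound:
  fixes k \<delta> R :: real
  assumes k: "0 < k" "k \<le> 1" and \<delta>: "0 < \<delta>" and R: "0 \<le> R"
  shows "\<exists>c \<mu>. 0 < c \<and> 0 < \<mu> \<and> \<mu> < 1 \<and>
    (\<forall>(E :: 'a::euclidean_space set) x0 \<epsilon>. E \<subseteq> cball x0 R \<and> 0 < \<epsilon> \<and>
        (\<forall>s. 4 * \<epsilon> \<le> s \<and> s \<le> \<delta> \<longrightarrow> porous_at_scale k s E) \<longrightarrow>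
      emeasure lebesgue E \<le> ennreal (c * \<epsilon> powr \<mu>))"
proof -
  define M where "M = 4 / k"
  define N where "N = M ^ DIM('a)"
  define q where "q = N / (1 + N)"
  define \<mu> where "\<mu> = - ln q / ln M"
  \<comment> \<open>Thickness \<open>\<rho>\<close> uses porosity at scale \<open>2 \<rho> / k\<close>, hence the range \<open>\<rho> \<le> D\<close>.\<close>
  define D where "D = k * \<delta> / 2"
  \<comment> \<open>A ball of this radius contains every thickening that occurs in the recursion.\<close>
  define V where "V = measure lborel (ball (0::'a) (R + M * D + 1))"
  define c where "c = V * (2 / D) powr \<mu>"
  have M: "4 \<le> M" using k by (simp add: M_def field_simps)
  have N: "1 \<le> N" using M by (simp add: N_def one_le_power)
  have q: "1 / 2 \<le> q" "q < 1" using N by (auto simp: q_def field_simps)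
  have D: "0 < D" using k \<delta> by (simp add: D_def)
  have \<mu>_pos: "0 < \<mu>" using q M by (auto simp: \<mu>_def divide_neg_pos)
  have "ln (1 / M) < ln q"
  proof (subst ln_less_cancel_iff)
    have "1 / M \<le> 1 / 4" using M by (intro divide_left_mono) auto
    then show "1 / M < q" using q by simp
  qed (use M q in auto)
  then have \<mu>_less: "\<mu> < 1" using M by (simp add: \<mu>_def ln_div field_simps)
  have \<mu>_eq: "M powr \<mu> * q = 1" using M q by (simp add: powr_def \<mu>_def exp_minus)
  have "0 \<le> M * D" using M D by simp
  then have V: "0 < V" unfolding V_def using R by (intro content_ball_pos) simp
  have c: "0 < c" using V D by (simp add: c_def)
  have ball_V: "emeasure lborel (ball x (R + M * D + 1)) = ennreal V" for x :: 'a
    using emeasure_ball_scale[of 1 "R + M * D + 1" x 0] R \<open>0 \<le> M * D\<close>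
      emeasure_lborel_ball_finite[of "0::'a" "R + M * D + 1"]
    unfolding V_def by (subst emeasure_eq_ennreal_measure[symmetric]) auto
  have *: "emeasure lebesgue E \<le> ennreal (c * \<epsilon> powr \<mu>)"
    if E: "E \<subseteq> cball x0 R" and \<epsilon>: "0 < \<epsilon>"
      and porous: "\<And>s. 4 * \<epsilon> \<le> s \<Longrightarrow> s \<le> \<delta> \<Longrightarrow> porous_at_scale k s E"
    for E :: "'a set" and x0 \<epsilon>
  proof -
    have c_eq: "V * (2 * \<epsilon> / D) powr \<mu> = c * \<epsilon> powr \<mu>"
      using \<epsilon> D by (simp add: c_def powr_mult powr_divide)
    have sub: "thickening \<rho> E \<subseteq> ball x0 (R + M * D + 1)" if "\<rho> \<le> M * D" for \<rho>
    proof
      fix w assume "w \<in> thickening \<rho> E"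
      then obtain e where "e \<in> E" "dist e w < \<rho>" by (auto simp: thickening_def)
      with E that show "w \<in> ball x0 (R + M * D + 1)" using dist_triangle[of x0 w e] by force
    qed
    have le_V: "emeasure lborel (thickening \<rho> E) \<le> ennreal V" if "\<rho> \<le> M * D" for \<rho>
      using emeasure_mono[OF sub[OF that], of lborel] by (simp add: ball_V)
    show ?thesis
    \<comment> \<open>For \<open>2 * \<epsilon>\<close> above the range of the recursion the trivial bound by \<open>V\<close> suffices.\<close>
    proof (cases "2 * \<epsilon> \<le> M * D")
      case True
      have em: "emeasure lborel (thickening \<rho> E) = ennreal (measure lborel (thickening \<rho> E))"
        if "\<rho> \<le> M * D" for \<rho>
        using le_V[OF that] by (intro emeasure_eq_ennreal_measure) (auto simp: top_unique)
      have "measure lborel (thickening (2 * \<epsilon>) E) \<le> V * (2 * \<epsilon> / D) powr \<mu>"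
      proof (rule geometric_decay_powr[where M = M and q = q and \<epsilon> = "2 * \<epsilon>"])
        fix \<rho> assume "\<rho> \<le> M * D"
        then show "measure lborel (thickening \<rho> E) \<le> V"
          using le_V em V by (metis ennreal_le_iff less_imp_le)
      next
        fix \<rho> assume \<rho>: "2 * \<epsilon> \<le> \<rho>" "\<rho> \<le> D"
        have "4 * \<epsilon> \<le> 2 * \<rho> / k"
        proof -
          have "4 * \<epsilon> * k \<le> 4 * \<epsilon> * 1" using \<epsilon> k by (intro mult_left_mono) auto
          then show ?thesis using k \<rho> by (simp add: field_simps)
        qed
        moreover have "2 * \<rho> / k \<le> \<delta>" using k \<rho> by (simp add: D_def field_simps)
        ultimately have "porous_at_scale k (2 * \<rho> / k) E" by (rule porous)
        moreover have "bounded E" using E bounded_cball bounded_subset by blast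
        ultimately show "measure lborel (thickening \<rho> E) \<le> q * measure lborel (thickening (M * \<rho>) E)"
          using measure_thickening_contracts[OF k, of \<rho> E] \<rho> \<epsilon> by (simp add: q_def N_def M_def)
      qed (use M q \<mu>_eq \<mu>_pos D V \<epsilon> True in auto)
      then have "emeasure lborel (thickening (2 * \<epsilon>) E) \<le> ennreal (c * \<epsilon> powr \<mu>)"
        using em[OF True] c_eq by (simp add: ennreal_leI)
      moreover have "E \<subseteq> thickening (2 * \<epsilon>) E" using \<epsilon> by (force simp: thickening_def)
      then have "emeasure lebesgue E \<le> emeasure lebesgue (thickening (2 * \<epsilon>) E)"
        using open_thickening[of "2 * \<epsilon>" E] by (intro emeasure_mono) auto
      ultimately show ?thesis using open_thickening[of "2 * \<epsilon>" E] by simp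
    next
      case False
      have "1 * D \<le> M * D" using M D by (intro mult_right_mono) auto
      with False have "D \<le> 2 * \<epsilon>" by simp
      then have "1 \<le> (2 * \<epsilon> / D) powr \<mu>"
        using D \<mu>_pos by (intro ge_one_powr_ge_zero) auto
      then have "V * 1 \<le> c * \<epsilon> powr \<mu>"
        unfolding c_eq[symmetric] using V by (intro mult_left_mono) auto
      moreover have "E \<subseteq> ball x0 (R + M * D + 1)" using E \<open>0 \<le> M * D\<close> by force
      then have "emeasure lebesgue E \<le> emeasure lebesgue (ball x0 (R + M * D + 1))"
        by (intro emeasure_mono) auto
      ultimately show ?thesis
        by (simp add: ball_V) (meson ennreal_leI order_trans)
    qed
  qed
  show ?thesis
    by (intro exI[of _ c] exI[of _ \<mu>] conjI allI impI c \<mu>_pos \<mu>_less, elim conjE, rule *)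
       (assumption | blast)+
qed

section \<open>The solution and its sublevel sets\<close>

context eikonal
begin

context
  fixes K :: "'a set"
  assumes K_nonempty: "K \<noteq> {}"
begin

abbreviation u :: "'a \<Rightarrow> real" where "u \<equiv> eikonal_solution H K"

lemma curve_costs_nonempty:
  "{curve_cost H L \<rho> |L \<rho>. unit_speed_curve L \<rho> \<and> \<rho> 0 = x \<and> \<rho> L \<in> K} \<noteq> {}"
proof -
  obtain k where "k \<in> K" using K_nonempty by blast
  moreover obtain \<rho> where "unit_speed_curve (dist x k) \<rho>" "\<rho> 0 = x" "\<rho> (dist x k) = k"
    by (rule unit_speed_segment)
  ultimately have "curve_cost H (dist x k) \<rho> \<in>
      {curve_cost H L \<rho> |L \<rho>. unit_speed_curve L \<rho> \<and> \<rho> 0 = x \<and> \<rho> L \<in> K}"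
    by (intro CollectI exI[of _ "dist x k"] exI[of _ \<rho>] conjI refl) simp_all
  then show ?thesis by (metis empty_iff)
qed

lemma near_optimal_curve:
  assumes "u x < t"
  obtains L \<rho> where "unit_speed_curve L \<rho>" "\<rho> 0 = x" "\<rho> L \<in> K" "curve_cost H L \<rho> < t"
proof -
  obtain c where "c \<in> {curve_cost H L \<rho> |L \<rho>. unit_speed_curve L \<rho> \<and> \<rho> 0 = x \<and> \<rho> L \<in> K}" "c < t"
    using cInf_lessD[OF curve_costs_nonempty assms[unfolded eikonal_solution_def]] by (elim bexE)
  then show thesis by (elim CollectE exE conjE) (simp add: that)
qed

lemma solution_nonneg: "0 \<le> u x"
  unfolding eikonal_solution_def
proof (rule cInf_greatest)
  show "{curve_cost H L \<rho> |L \<rho>. unit_speed_curve L \<rho> \<and> \<rho> 0 = x \<and> \<rho> L \<in> K} \<noteq> {}"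
    by (rule curve_costs_nonempty)
qed (auto intro: curve_cost_nonneg)

lemma solution_zero: "x \<in> K \<Longrightarrow> u x = 0"
  using eikonal_solution_le_cost[OF unit_speed_curve_point[of x], of K]
    curve_cost_upper[OF unit_speed_curve_point[of x]] solution_nonneg[of x] by simp

text \<open>
  Going straight from \<open>x\<close> to \<open>y\<close> and then along a nearly optimal curve is one way to reach \<open>K\<close>.
\<close>

lemma solution_lipschitz: "u x \<le> u y + dist x y / a"
proof (rule field_le_epsilon)
  fix e :: real assume "0 < e"
  then have "u y < u y + e" by simp
  then obtain L \<rho> where \<rho>: "unit_speed_curve L \<rho>" "\<rho> 0 = y" "\<rho> L \<in> K" "curve_cost H L \<rho> < u y + e"
    by (rule near_optimal_curve)
  obtain \<sigma> where \<sigma>: "unit_speed_curve (dist x y) \<sigma>" "\<sigma> 0 = x" "\<sigma> (dist x y) = y"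
    by (rule unit_speed_segment)
  let ?j = "join_curves (dist x y) \<sigma> \<rho>"
  have meet: "\<sigma> (dist x y) = \<rho> 0" using \<sigma> \<rho> by simp
  have L: "0 \<le> L" using unit_speed_curveD(1)[OF \<rho>(1)] .
  have "?j 0 = x" by (simp add: join_curves_def \<sigma>)
  moreover have "?j (dist x y + L) \<in> K"
    using L meet \<rho>(3) by (cases "L = 0") (auto simp: join_curves_def)
  ultimately have "u x \<le> curve_cost H (dist x y + L) ?j"
    using eikonal_solution_le_cost[OF unit_speed_curve_join[OF \<sigma>(1) \<rho>(1) meet], of K] by simp
  also have "\<dots> = curve_cost H (dist x y) \<sigma> + curve_cost H L \<rho>"
    by (rule curve_cost_join[OF \<sigma>(1) \<rho>(1) meet])
  also have "\<dots> \<le> dist x y / a + (u y + e)"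
    using curve_cost_upper[OF \<sigma>(1)] \<rho>(4) by simp
  finally show "u x \<le> u y + dist x y / a + e" by simp
qed

lemma continuous_solution: "continuous_on UNIV u"
proof (rule lipschitz_on_continuous_on)
  show "(1 / a)-lipschitz_on UNIV u"
  proof (rule lipschitz_onI)
    show "dist (u x) (u y) \<le> 1 / a * dist x y" for x y
      using solution_lipschitz[of x y] solution_lipschitz[of y x]
      by (simp add: dist_real_def abs_le_iff dist_commute)
  qed (use a_pos in simp)
qed

lemma open_reached_set: "open (reached_set H K t)"
  unfolding reached_set_def
  by (rule open_Collect_less) (use continuous_solution in simp_all)

lemma frontier_reached_set: "x \<in> frontier (reached_set H K t) \<Longrightarrow> u x = t"
proof -
  assume x: "x \<in> frontier (reached_set H K t)"
  have "closed {x. u x \<le> t}"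
    by (rule closed_Collect_le) (use continuous_solution in simp_all)
  then have "closure (reached_set H K t) \<subseteq> {x. u x \<le> t}"
    by (intro closure_minimal) (auto simp: reached_set_def)
  then have "u x \<le> t" using x by (auto simp: frontier_def)
  moreover have "x \<notin> reached_set H K t"
    using x open_reached_set[of t] by (simp add: frontier_def interior_open)
  ultimately show "u x = t" by (simp add: reached_set_def)
qed

lemma reached_set_superset: "0 < t \<Longrightarrow> K \<subseteq> reached_set H K t"
  by (auto simp: reached_set_def solution_zero)

lemma reached_set_near_K:
  assumes "x \<in> reached_set H K t"
  shows "\<exists>k\<in>K. dist x k \<le> b * t"
proof -
  from assms have "u x < t" by (simp add: reached_set_def)
  then obtain L \<rho> where \<rho>: "unit_speed_curve L \<rho>" "\<rho> 0 = x" "\<rho> L \<in> K" "curve_cost H L \<rho> < t"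
    by (rule near_optimal_curve)
  have "dist (\<rho> 0) (\<rho> L) \<le> L - 0"
    by (rule unit_speed_1_lipschitz[OF \<rho>(1)]) (use unit_speed_curveD(1)[OF \<rho>(1)] in auto)
  moreover have "L \<le> b * t"
  proof -
    have "L / b \<le> t" using curve_cost_lower[OF \<rho>(1)] \<rho>(4) by simp
    then show ?thesis using b_pos by (simp add: field_simps)
  qed
  ultimately show ?thesis using \<rho>(2,3) by (intro bexI[of _ "\<rho> L"]) auto
qed

text \<open>
  Follow a curve of cost less than \<open>t\<close> for length \<open>b (t - r)\<close>. This uses up cost at least \<open>t - r\<close>, so the
  remaining cost is below \<open>r\<close>, unless \<open>K\<close> has been reached before.
\<close>

lemma reached_set_near_earlier:
  assumes x: "x \<in> reached_set H K t" and r: "0 < r" "r \<le> t"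
  shows "\<exists>z\<in>reached_set H K r. dist x z \<le> b * (t - r)"
proof -
  from x have "u x < t" by (simp add: reached_set_def)
  then obtain L \<rho> where \<rho>: "unit_speed_curve L \<rho>" "\<rho> 0 = x" "\<rho> L \<in> K" "curve_cost H L \<rho> < t"
    by (rule near_optimal_curve)
  \<comment> \<open>The minimum with \<open>L\<close> covers curves that reach \<open>K\<close> early.\<close>
  define s where "s = min L (b * (t - r))"
  have "0 \<le> b * (t - r)" using b_pos r by simp
  then have s: "0 \<le> s" "s \<le> L" "s \<le> b * (t - r)"
    using unit_speed_curveD(1)[OF \<rho>(1)] by (auto simp: s_def)
  have "u (\<rho> s) < r"
  proof (cases "s = L")
    case True
    then show ?thesis using \<rho>(3) r by (simp add: solution_zero)
  next
    case False
    then have "s / b = t - r" using b_pos by (simp add: s_def split: if_splits)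
    then show ?thesis
      using eikonal_solution_le_cost_tail[OF \<rho>(1,3) s(1,2)] \<rho>(4) by simp
  qed
  moreover have "dist (\<rho> 0) (\<rho> s) \<le> s - 0"
    by (rule unit_speed_1_lipschitz[OF \<rho>(1)]) (use s in auto)
  ultimately show ?thesis using s \<rho>(2) by (intro bexI[of _ "\<rho> s"]) (simp_all add: reached_set_def)
qed

text \<open>
  Needed because \<open>infdist\<close> to the empty set is \<open>0\<close>, which would contradict a positive lower bound.
\<close>

lemma frontier_reached_set_nonempty:
  assumes "0 < t" "bounded K"
  shows "frontier (reached_set H K t) \<noteq> {}"
proof -
  obtain R where R: "\<forall>k\<in>K. dist 0 k \<le> R"
    using assms(2) unfolding bounded_any_center[of K 0] by (elim exE)
  have "reached_set H K t \<subseteq> cball 0 (R + b * t)"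
  proof (rule subsetI)
    fix x assume x: "x \<in> reached_set H K t"
    obtain k where k: "k \<in> K" "dist x k \<le> b * t"
      using reached_set_near_K[OF x] by (elim bexE)
    have "dist 0 k \<le> R" using bspec[OF R k(1)] .
    then show "x \<in> cball 0 (R + b * t)"
      using k(2) dist_triangle2[of 0 x k] unfolding mem_cball by linarith
  qed
  then have "bounded (reached_set H K t)" by (rule bounded_subset[OF bounded_cball])
  then have "reached_set H K t \<noteq> UNIV" using not_bounded_UNIV by metis
  moreover have "reached_set H K t \<noteq> {}"
    using reached_set_superset[OF assms(1)] K_nonempty by blast
  ultimately show ?thesis unfolding frontier_eq_empty by blast
qed

lemma frontier_separation:
  assumes "0 < r" "r \<le> t" "bounded K" "x \<in> frontier (reached_set H K t)"
  shows "a * (t - r) \<le> infdist x (frontier (reached_set H K r))"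
proof -
  have "a * (t - r) \<le> dist x y" if y: "y \<in> frontier (reached_set H K r)" for y
  proof -
    have "t - r \<le> dist x y / a"
      using solution_lipschitz[of x y] frontier_reached_set[OF y] frontier_reached_set[OF assms(4)]
      by linarith
    then show ?thesis using a_pos by (simp add: pos_le_divide_eq mult.commute)
  qed
  then show ?thesis
    unfolding infdist_notempty[OF frontier_reached_set_nonempty[OF assms(1,3)]]
    by (intro cINF_greatest frontier_reached_set_nonempty[OF assms(1,3)])
qed

lemma ball_subset_reached_set: "ball y (a * (t - u y)) \<subseteq> reached_set H K t"
proof
  fix w assume "w \<in> ball y (a * (t - u y))"
  then have "dist w y < a * (t - u y)" by (simp add: dist_commute)
  then have "dist w y / a < t - u y" using a_pos by (simp add: pos_divide_less_eq mult.commute)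
  then show "w \<in> reached_set H K t"
    using solution_lipschitz[of w y] by (simp add: reached_set_def)
qed

section \<open>Porosity from the John condition\<close>

text \<open>
  From any point of the sublevel set, walk for length at most \<open>s\<close> towards \<open>x0\<close>. If a nearly optimal curve to
  \<open>K\<close> lasts for \<open>s / 2\<close>, then there \<open>u\<close> has dropped below \<open>r\<close> by \<open>s / (2 b)\<close> and the Lipschitz bound provides
  the ball. If it ends earlier, spend another \<open>s / 2\<close> on a John curve in \<open>K\<close>; its distance to the frontier
  provides the ball. If that curve ends too, \<open>x0\<close> has been reached, which is at distance at least \<open>s\<close>
  from the frontier of \<open>K\<close>.
\<close>

lemma reached_set_corkscrew:
  assumes john: "john_domain K x0 \<kappa>" and r: "0 < r"
    and s: "0 < s" "s \<le> infdist x0 (frontier K)" and z: "z \<in> reached_set H K r"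
  shows "\<exists>y. dist z y \<le> s \<and> ball y (min (a / b) \<kappa> / 2 * s) \<subseteq> reached_set H K r"
proof -
  define k where "k = min (a / b) \<kappa> / 2"
  have \<kappa>: "0 < \<kappa>" "\<kappa> \<le> 1" using john by (auto simp: john_domain_def)
  have k: "k \<le> a / b / 2" "k \<le> \<kappa> / 2" "k \<le> 1" using \<kappa> by (auto simp: k_def)
  have sub: "ball y (k * s) \<subseteq> ball y R" if "k * s \<le> R" for y :: 'a and R
    using that by (rule subset_ball)
  have KU: "K \<subseteq> reached_set H K r" by (rule reached_set_superset[OF r])
  from z have "u z < r" by (simp add: reached_set_def)
  then obtain L \<rho> where \<rho>: "unit_speed_curve L \<rho>" "\<rho> 0 = z" "\<rho> L \<in> K" "curve_cost H L \<rho> < r"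
    by (rule near_optimal_curve)
  note L = unit_speed_curveD(1)[OF \<rho>(1)]
  have "\<exists>y. dist z y \<le> s \<and> ball y (k * s) \<subseteq> reached_set H K r"
  proof (cases "s / 2 \<le> L")
    case True
    let ?y = "\<rho> (s / 2)"
    have "dist (\<rho> 0) ?y \<le> s / 2 - 0"
      by (rule unit_speed_1_lipschitz[OF \<rho>(1)]) (use s True in auto)
    moreover have "k * s \<le> a * (r - u ?y)"
    proof -
      have "s / 2 / b \<le> r - u ?y"
        using eikonal_solution_le_cost_tail[OF \<rho>(1,3), of "s / 2"] s True \<rho>(4) by simp
      then have "a * (s / 2 / b) \<le> a * (r - u ?y)"
        using a_pos by (intro mult_left_mono) auto
      moreover have "k * s \<le> a / b / 2 * s" using k s by (intro mult_right_mono) auto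
      ultimately show ?thesis by simp
    qed
    ultimately show ?thesis
      using ball_subset_reached_set[of ?y r] sub[of "a * (r - u ?y)" ?y] s \<rho>(2)
      by (intro exI[of _ ?y]) auto
  next
    case False
    let ?z = "\<rho> L"
    have zz: "dist z ?z \<le> s / 2"
      using unit_speed_1_lipschitz[OF \<rho>(1), of 0 L] L False \<rho>(2) by simp
    obtain L' \<gamma> where \<gamma>: "unit_speed_curve L' \<gamma>" "\<gamma> ` {0..L'} \<subseteq> K" "\<gamma> 0 = ?z" "\<gamma> L' = x0"
      "\<And>q. q \<in> {0..L'} \<Longrightarrow> \<kappa> * q \<le> infdist (\<gamma> q) (frontier K)"
      by (rule john_domain_curve[OF john \<rho>(3)]) blast
    note L' = unit_speed_curveD(1)[OF \<gamma>(1)]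
    show ?thesis
    proof (cases "s / 2 \<le> L'")
      case True
      let ?y = "\<gamma> (s / 2)"
      have "dist ?z ?y \<le> s / 2"
        using unit_speed_1_lipschitz[OF \<gamma>(1), of 0 "s / 2"] True s \<gamma>(3) by simp
      then have "dist z ?y \<le> s" using zz dist_triangle[of z ?y ?z] by simp
      moreover have "k * s \<le> infdist ?y (frontier K)"
      proof -
        have "k * s \<le> \<kappa> / 2 * s" using k s by (intro mult_right_mono) auto
        also have "\<kappa> / 2 * s \<le> infdist ?y (frontier K)"
          using \<gamma>(5)[of "s / 2"] True s by simp
        finally show ?thesis .
      qed
      moreover have "?y \<in> K" using \<gamma>(2) True s by auto
      ultimately show ?thesis
        using ball_infdist_frontier_subset[of ?y K] sub[of "infdist ?y (frontier K)" ?y] KU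
        by (intro exI[of _ ?y]) auto
    next
      case False
      have "dist ?z x0 \<le> s / 2"
        using unit_speed_1_lipschitz[OF \<gamma>(1), of 0 L'] False L' \<gamma>(3,4) by simp
      then have "dist z x0 \<le> s" using zz dist_triangle[of z x0 ?z] by simp
      moreover have "k * s \<le> infdist x0 (frontier K)"
      proof -
        have "k * s \<le> 1 * s" using k s by (intro mult_right_mono) auto
        then show ?thesis using s by linarith
      qed
      moreover have "x0 \<in> K" using john by (simp add: john_domain_def)
      ultimately show ?thesis
        using ball_infdist_frontier_subset[of x0 K] sub[of "infdist x0 (frontier K)" x0] KU
        by (intro exI[of _ x0]) auto
    qed
  qed
  then show ?thesis unfolding k_def .
qed

text \<open>
  A point of the annulus is within \<open>b (t - r) \<le> s / 4\<close> of the smaller sublevel set, and the corkscrew ball of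
  scale \<open>s / 2\<close> found from there lies in that set, hence outside the annulus.
\<close>

lemma porous_reached_annulus:
  assumes john: "john_domain K x0 \<kappa>" and r: "0 < r" "r \<le> t"
    and s: "0 < s" "s \<le> infdist x0 (frontier K)" "4 * (b * (t - r)) \<le> s"
  shows "porous_at_scale (min (a / b) \<kappa> / 4) s (reached_set H K t - reached_set H K r)"
  unfolding porous_at_scale_def
proof
  fix x assume "x \<in> reached_set H K t - reached_set H K r"
  then obtain z where z: "z \<in> reached_set H K r" "dist x z \<le> b * (t - r)"
    using reached_set_near_earlier[of x t r] r by blast
  obtain y where y: "dist z y \<le> s / 2" "ball y (min (a / b) \<kappa> / 2 * (s / 2)) \<subseteq> reached_set H K r"
    using reached_set_corkscrew[OF john r(1), of "s / 2" z] s z(1) by auto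
  have "dist x y \<le> s" using dist_triangle[of x y z] z(2) y(1) s by simp
  moreover have "ball y (min (a / b) \<kappa> / 4 * s) \<inter> (reached_set H K t - reached_set H K r) = {}"
    using y(2) by auto
  ultimately show "\<exists>y. dist x y \<le> s \<and>
      ball y (min (a / b) \<kappa> / 4 * s) \<inter> (reached_set H K t - reached_set H K r) = {}" by blast
qed

text \<open>
  The John condition at the end point \<open>x0\<close> bounds the length of every John curve by
  \<open>d(x0, \<partial>K) / \<kappa>\<close>, which bounds \<open>K\<close>.
\<close>

lemma reached_set_in_cball:
  assumes john: "john_domain K x0 \<kappa>" and t: "t \<le> T"
  shows "reached_set H K t \<subseteq> cball x0 (infdist x0 (frontier K) / \<kappa> + b * T)"
proof
  fix x assume x: "x \<in> reached_set H K t"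
  obtain k where k: "k \<in> K" "dist x k \<le> b * t"
    using reached_set_near_K[OF x] by (elim bexE)
  obtain L \<gamma> where \<gamma>: "unit_speed_curve L \<gamma>" "\<gamma> 0 = k" "\<gamma> L = x0"
    "\<And>q. q \<in> {0..L} \<Longrightarrow> \<kappa> * q \<le> infdist (\<gamma> q) (frontier K)"
    by (rule john_domain_curve[OF john k(1)]) blast
  have \<kappa>: "0 < \<kappa>" using john by (simp add: john_domain_def)
  note L = unit_speed_curveD(1)[OF \<gamma>(1)]
  have "\<kappa> * L \<le> infdist x0 (frontier K)" using \<gamma>(4)[of L] L \<gamma>(3) by simp
  then have "L \<le> infdist x0 (frontier K) / \<kappa>" using \<kappa> by (simp add: field_simps)
  moreover have "dist k x0 \<le> L"
    using unit_speed_1_lipschitz[OF \<gamma>(1), of 0 L] L \<gamma> by simp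
  moreover have "b * t \<le> b * T" using t b_pos by simp
  ultimately show "x \<in> cball x0 (infdist x0 (frontier K) / \<kappa> + b * T)"
    using dist_triangle[of x x0 k] k(2) by (simp add: dist_commute)
qed

end

end

lemma infdist_frontier_pos:
  fixes K :: "'a::euclidean_space set"
  assumes "compact K" "x0 \<in> interior K"
  shows "0 < infdist x0 (frontier K)"
proof (rule infdist_pos_not_in_closed)
  have "K \<noteq> UNIV" using compact_imp_bounded[OF assms(1)] not_bounded_UNIV by blast
  moreover have "K \<noteq> {}" using assms(2) by auto
  ultimately show "frontier K \<noteq> {}" by (simp add: frontier_eq_empty)
qed (use assms in \<open>auto simp: frontier_def\<close>)

section \<open>The estimates\<close>

theorem proposition1p2:
  fixes \<alpha>1 \<alpha>2 :: real
  assumes "0 < \<alpha>1" and "\<alpha>1 \<le> \<alpha>2"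
  shows "(\<forall>(H :: real ^ 'n \<Rightarrow> real ^ 'n \<Rightarrow> real) K.
            admissible_hamiltonian \<alpha>1 \<alpha>2 H \<and> K \<noteq> {} \<and> compact K \<and> connected K \<longrightarrow>
            (\<forall>r t. 0 < r \<and> r \<le> t \<longrightarrow>
               ereal (\<alpha>1 * (t - r)) \<le>
                 (INF x\<in>frontier (reached_set H K t). ereal (infdist x (frontier (reached_set H K r)))) \<and>
               (SUP x\<in>reached_set H K t. ereal (infdist x (reached_set H K r))) \<le>
                 ereal (\<alpha>2 * (t - r))))
       \<and> (\<forall>\<kappa>0 \<delta> T. 0 < \<kappa>0 \<and> \<kappa>0 \<le> 1 \<and> 0 < T \<longrightarrow>
            (\<exists>c \<mu>. 0 < c \<and> 0 < \<mu> \<and> \<mu> < 1 \<and>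
               (\<forall>(H :: real ^ 'n \<Rightarrow> real ^ 'n \<Rightarrow> real) K x0.
                  admissible_hamiltonian \<alpha>1 \<alpha>2 H \<and> K \<noteq> {} \<and> compact K \<and> connected K \<and>
                  x0 \<in> interior K \<and> john_domain K x0 \<kappa>0 \<and> infdist x0 (frontier K) = \<delta> \<longrightarrow>
                  (\<forall>r t. 0 < r \<and> r \<le> t \<and> t \<le> T \<longrightarrow>
                     emeasure lebesgue (reached_set H K t - reached_set H K r)
                       \<le> ennreal (c * (t - r) powr \<mu>)))))"
proof (intro conjI allI impI; elim conjE)
  fix H :: "real ^ 'n \<Rightarrow> real ^ 'n \<Rightarrow> real" and K :: "(real ^ 'n) set" and r t :: real
  assume H: "admissible_hamiltonian \<alpha>1 \<alpha>2 H" and K: "K \<noteq> {}" "compact K" and rt: "0 < r" "r \<le> (t::real)"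
  interpret eikonal \<alpha>1 \<alpha>2 H by unfold_locales fact+
  show "ereal (\<alpha>1 * (t - r)) \<le>
      (INF x\<in>frontier (reached_set H K t). ereal (infdist x (frontier (reached_set H K r))))"
    using frontier_separation[OF K(1) rt compact_imp_bounded[OF K(2)]]
    by (intro INF_greatest) simp
  show "(SUP x\<in>reached_set H K t. ereal (infdist x (reached_set H K r))) \<le> ereal (\<alpha>2 * (t - r))"
  proof (rule SUP_least)
    fix x assume "x \<in> reached_set H K t"
    then obtain z where "z \<in> reached_set H K r" "dist x z \<le> \<alpha>2 * (t - r)"
      using reached_set_near_earlier[OF K(1) _ rt] by blast
    then show "ereal (infdist x (reached_set H K r)) \<le> ereal (\<alpha>2 * (t - r))"
      by (simp add: infdist_le2)
  qed
next
  fix \<kappa>0 \<delta> T :: real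
  assume \<kappa>0: "0 < \<kappa>0" "\<kappa>0 \<le> 1" and T: "0 < T"
  have \<alpha>2: "0 < \<alpha>2" using assms by simp
  show "\<exists>c \<mu>. 0 < c \<and> 0 < \<mu> \<and> \<mu> < 1 \<and>
               (\<forall>(H :: real ^ 'n \<Rightarrow> real ^ 'n \<Rightarrow> real) K x0.
                  admissible_hamiltonian \<alpha>1 \<alpha>2 H \<and> K \<noteq> {} \<and> compact K \<and> connected K \<and>
                  x0 \<in> interior K \<and> john_domain K x0 \<kappa>0 \<and> infdist x0 (frontier K) = \<delta> \<longrightarrow>
                  (\<forall>r t. 0 < r \<and> r \<le> t \<and> t \<le> T \<longrightarrow>
                     emeasure lebesgue (reached_set H K t - reached_set H K r)
                       \<le> ennreal (c * (t - r) powr \<mu>)))"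
  \<comment> \<open>For \<open>\<delta> \<le> 0\<close> there is no such \<open>K\<close>, and any constants do.\<close>
  proof (cases "0 < \<delta>")
    case False
    then show ?thesis
      using infdist_frontier_pos by - (rule exI[of _ 1], rule exI[of _ "1 / 2"], auto)
  next
    case True
    define k where "k = min (\<alpha>1 / \<alpha>2) \<kappa>0 / 4"
    have k: "0 < k" "k \<le> 1" using assms \<alpha>2 \<kappa>0 by (auto simp: k_def)
    have "0 \<le> \<delta> / \<kappa>0 + \<alpha>2 * T" using True \<kappa>0 \<alpha>2 T by simp
    from porous_volume_bound[OF k True this, where ?'a = "real ^ 'n"]
    obtain c \<mu> where c: "0 < c" and \<mu>: "0 < \<mu>" "\<mu> < 1"
      and bound: "\<And>(E :: (real ^ 'n) set) x0 \<epsilon>. E \<subseteq> cball x0 (\<delta> / \<kappa>0 + \<alpha>2 * T) \<Longrightarrow> 0 < \<epsilon> \<Longrightarrow>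
          (\<And>s. 4 * \<epsilon> \<le> s \<Longrightarrow> s \<le> \<delta> \<Longrightarrow> porous_at_scale k s E) \<Longrightarrow>
          emeasure lebesgue E \<le> ennreal (c * \<epsilon> powr \<mu>)"
      by metis
    have estimate: "emeasure lebesgue (reached_set H K t - reached_set H K r)
        \<le> ennreal (c * \<alpha>2 powr \<mu> * (t - r) powr \<mu>)"
      if H: "admissible_hamiltonian \<alpha>1 \<alpha>2 H" and K: "K \<noteq> {}" and john: "john_domain K x0 \<kappa>0"
        and \<delta>: "infdist x0 (frontier K) = \<delta>" and r: "0 < r" "r \<le> t" "t \<le> T"
      for H :: "real ^ 'n \<Rightarrow> real ^ 'n \<Rightarrow> real" and K :: "(real ^ 'n) set" and x0 r t
    proof (cases "r = t")
      case True
      then show ?thesis by simp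
    next
      case False
      then have \<epsilon>: "0 < \<alpha>2 * (t - r)" using r \<alpha>2 by simp
      interpret eikonal \<alpha>1 \<alpha>2 H by unfold_locales fact+
      have "emeasure lebesgue (reached_set H K t - reached_set H K r)
          \<le> ennreal (c * (\<alpha>2 * (t - r)) powr \<mu>)"
      proof (rule bound[OF _ \<epsilon>])
        show "reached_set H K t - reached_set H K r \<subseteq> cball x0 (\<delta> / \<kappa>0 + \<alpha>2 * T)"
          using reached_set_in_cball[OF K john r(3)] \<delta> by auto
        fix s assume s: "4 * (\<alpha>2 * (t - r)) \<le> s" "s \<le> \<delta>"
        with \<epsilon> have "0 < s" by linarith
        then show "porous_at_scale k s (reached_set H K t - reached_set H K r)"
          unfolding k_def using porous_reached_annulus[OF K john r(1,2)] s \<delta> by simp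
      qed
      also have "c * (\<alpha>2 * (t - r)) powr \<mu> = c * \<alpha>2 powr \<mu> * (t - r) powr \<mu>"
        using \<alpha>2 r by (simp add: powr_mult)
      finally show ?thesis .
    qed
    have pos: "0 < c * \<alpha>2 powr \<mu>" using c \<alpha>2 by simp
    show ?thesis
      by (rule exI[of _ "c * \<alpha>2 powr \<mu>"], rule exI[of _ \<mu>], intro conjI allI impI pos \<mu>;
          elim conjE; rule estimate; assumption)
  qed
qed

end
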